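(* The category of DRC-restriction semigroups together with $(2,1,1)$-homomorphisms is isomorphic to the category of chain projection ordered categories together with chain projection ordered functors.
   Context: Maps are written on the right and composed from left to right. **DRC-restriction semigroups.** A DRC semigroup is a semigroup $(S,\cdot)$ with two unary operations ${}^+,{}^\ast$ such that for all $x,y\in S$: $x^+x=x$, $(xy)^+=(xy^+)^+$, $(xy)^+=x^+(xy)^+x^+$, $x^{++}=x^+$, $x^{+\ast}=x^+$; and $xx^\ast=x$, $(xy)^\ast=(x^\ast y)^\ast$, $(xy)^\ast=y^\ast(xy)^\ast y^\ast$, $x^{\ast\ast}=x^\ast$, $x^{\ast+}=x^\ast$. It is DRC-restriction if moreover $x(yx)^\ast=(yx^+)^\ast x$ and $(xy)^+x=x(x^\ast y)^+$ for all $x,y$. A $(2,1,1)$-homomorphism is a map preserving $\cdot$, ${}^+$ and ${}^\ast$. **Projection algebras.** A projection algebra $(P,\times,\star)$ is a nonempty set with two binary operations such that for all $e,f,g\in P$: (L1) $e\times e=e$; (L2) $(e\times f)\times e=e\times f$; (L3) $e\times(f\times g)=(e\times f)\times(f\times g)$; (L4) $(e\times f)\times g=(e\times f)\times(e\times g)$; (R1) $e\star e=e$; (R2) $f\star e=e\star(f\star e)$; (R3) $(g\star f)\star e=(g\star f)\star(f\star e)$; (R4) $g\star(f\star e)=(g\star e)\star(f\star e)$; (P3) $(e\star(f\times g))\star g=(e\star f)\star g$ and $g\times((g\star f)\times e)=g\times(f\times e)$; (P4) $(e\times f)\star e=e\times f$ and $f\times(e\star f)=e\star f$. It is strong if moreover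 $e\times(((e\times f)\times g)\star f)=(e\times f)\times g$ and $(f\times(g\star(f\star e)))\star e=g\star(f\star e)$ for all $e,f,g$. Its natural partial order is $e\leq_P f\iff e=f\times e$. Write $p\,\mathcal F_P\,q$ iff $p\times q=p$ and $p\star q=q$. **Ordered categories.** A (small) category $(C,\circ,\mathbf d,\mathbf r)$ is a nonempty set $C$ with a partial binary operation $\circ$ and maps $\mathbf d,\mathbf r:C\to C$ such that: $x\circ y$ is defined iff $\mathbf r(x)=\mathbf d(y)$, and then $\mathbf d(x\circ y)=\mathbf d(x)$, $\mathbf r(x\circ y)=\mathbf r(y)$; $(x\circ y)\circ z=x\circ(y\circ z)$ whenever $x\circ y$, $y\circ z$ are defined; $\mathbf d(x)\circ x$ and $x\circ\mathbf r(x)$ are defined and both equal $x$. Its set of objects is $P_C=\{\mathbf d(x):x\in C\}=\{\mathbf r(x):x\in C\}$. An ordered category has in addition a partial order $\leq$ on $C$ with: (O1) $a\leq b$ implies $\mathbf d(a)\leq\mathbf d(b)$ and $\mathbf r(a)\leq\mathbf r(b)$; (O2) $a\leq b$, $c\leq d$, $\mathbf r(a)=\mathbf d(c)$, $\mathbf r(b)=\mathbf d(d)$ imply $a\circ c\leq b\circ d$; (O3) if $p\in P_C$, $p\leq\mathbf d(a)$, there is a unique $u\leq a$ with $\mathbf d(u)=p$, denoted ${}_p{\downharpoonleft}a$; (O4) if $q\in P_C$, $q\leq\mathbf r(a)$, there is a unique $v\leq a$ with $\mathbf r(v)=q$, denoted $a{\downharpoonright}_q$. **Path category.** For a strong projection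 algebra $P$, $\mathscr P(P)$ is the set of all tuples ($P$-paths) $(p_1,\dots,p_k)$, $k\geq1$, $p_i\in P$, with $p_1\,\mathcal F_P\,p_2\,\mathcal F_P\cdots\mathcal F_P\,p_k$. Put $\mathbf d(p_1,\dots,p_k)=p_1$, $\mathbf r(p_1,\dots,p_k)=p_k$ (identifying $p$ with the path $(p)$), and $(p_1,\dots,p_k)\circ(q_1,\dots,q_l)=(p_1,\dots,p_k,q_2,\dots,q_l)$ when $p_k=q_1$. For $q\leq_P p_1$ put ${}_q{\downharpoonleft}(p_1,\dots,p_k)=(q_1,\dots,q_k)$ with $q_1=q$, $q_i=q_{i-1}\star p_i$. Order: $\mathfrak p\leq_{\mathscr P}\mathfrak q$ iff $\mathfrak p={}_r{\downharpoonleft}\mathfrak q$ for some $r\leq_P\mathbf d(\mathfrak q)$. **Chain projection ordered categories.** A weak projection ordered category $(C,\circ,\mathbf d,\mathbf r,\leq,P_C,\times,\star)$ is an ordered category with operations $\times,\star$ making $P_C$ a strong projection algebra such that for $p,q\in P_C$: $p\leq q\iff p\leq_{P_C}q$. For $s\in P_C$ put $s^\downarrow=\{x\in P_C: x\leq s\}$ (a subalgebra). For $a\in C$ let $\nu_a:\mathbf d(a)^\downarrow\to\mathbf r(a)^\downarrow$, $p\mapsto\mathbf r({}_p{\downharpoonleft}a)$; and for $x\in P_C$ let $x\Theta_a=\mathbf r({}_{x\star\mathbf d(a)}{\downharpoonleft}a)$, $x\Delta_a=\mathbf d(a{\downharpoonright}_{\mathbf r(a)\times x})$. It is a projection ordered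 category if every $\nu_a$ is a homomorphism of projection algebras. An evaluation map is a map $\varepsilon:\mathscr P(P_C)\to C$ such that for all $p\in P_C$ and $\mathfrak p,\mathfrak q\in\mathscr P(P_C)$: (E1) $\varepsilon(p)=\varepsilon(p,p)=p$; (E2) $\mathbf d(\varepsilon(\mathfrak p))=\mathbf d(\mathfrak p)$, $\mathbf r(\varepsilon(\mathfrak p))=\mathbf r(\mathfrak p)$; (E3) $\varepsilon(\mathfrak p\circ\mathfrak q)=\varepsilon(\mathfrak p)\circ\varepsilon(\mathfrak q)$ when $\mathfrak p\circ\mathfrak q$ is defined; (E4) $\mathfrak p\leq_{\mathscr P}\mathfrak q$ implies $\varepsilon(\mathfrak p)\leq\varepsilon(\mathfrak q)$. For $b\in C$, a pair $(e,f)\in P_C\times P_C$ is $b$-linked if $f=(e\Theta_b)\star f$ and $e=e\times(f\Delta_b)$. For such a pair put $e_1=e\star\mathbf d(b)$, $e_2=f\Delta_b$, $f_1=e\Theta_b$, $f_2=\mathbf r(b)\times f$, and (all composites are defined) $\lambda(e,b,f)=\varepsilon(e,e_1)\circ{}_{e_1}{\downharpoonleft}b\circ\varepsilon(f_1,f)$, $\rho(e,b,f)=\varepsilon(e,e_2)\circ{}_{e_2}{\downharpoonleft}b\circ\varepsilon(f_2,f)$. A chain projection ordered category $(C,\circ,\mathbf d,\mathbf r,\leq,P_C,\times,\star,\varepsilon)$ is a projection ordered category with an evaluation map $\varepsilon$ such that (G2) $\lambda(e,b,f)=\rho(e,b,f)$ for all $b\in C$ and all $b$-linked pairs $(e,f)$.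 **Chain projection ordered functors.** A map $\phi:C_1\to C_2$ between chain projection ordered categories (with evaluation maps $\varepsilon_1,\varepsilon_2$) is a chain projection ordered functor if: (F1) $\mathbf d(a\phi)=(\mathbf d(a))\phi$, $\mathbf r(a\phi)=(\mathbf r(a))\phi$; (F2) $(a\circ b)\phi=(a\phi)\circ(b\phi)$ whenever $a\circ b$ is defined; (F3) $a\leq b$ implies $a\phi\leq b\phi$; (F4) $(e\times f)\phi=e\phi\times f\phi$ and $(e\star f)\phi=e\phi\star f\phi$ for $e,f\in P_{C_1}$; (F5) $(\varepsilon_1(p_1,\dots,p_k))\phi=\varepsilon_2(p_1\phi,\dots,p_k\phi)$ for all $(p_1,\dots,p_k)\in\mathscr P(P_{C_1})$. *)

theory Defs
  imports "HOL-Library.FuncSet"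
begin

section \<open>Categories, functors and isomorphism of categories\<close>

text \<open>Objects and arrows range over subsets of the types \<open>'o\<close> and \<open>'m\<close>.
  Composition is written in diagrammatic order: \<open>Comp A f g\<close> is first \<open>f\<close>, then \<open>g\<close>,
  and is meaningful only when \<open>Cod A f = Dom A g\<close>.\<close>

record ('o, 'm) cat =
  Obj :: "'o set"
  Arr :: "'m set"
  Dom :: "'m \<Rightarrow> 'o"
  Cod :: "'m \<Rightarrow> 'o"
  Ident :: "'o \<Rightarrow> 'm"
  Comp :: "'m \<Rightarrow> 'm \<Rightarrow> 'm"

locale is_category =
  fixes A :: "('o, 'm) cat"
  assumes Dom_in: "f \<in> Arr A \<Longrightarrow> Dom A f \<in> Obj A"
    and Cod_in: "f \<in> Arr A \<Longrightarrow> Cod A f \<in> Obj A"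
    and Ident_in: "X \<in> Obj A \<Longrightarrow> Ident A X \<in> Arr A"
    and Dom_Ident: "X \<in> Obj A \<Longrightarrow> Dom A (Ident A X) = X"
    and Cod_Ident: "X \<in> Obj A \<Longrightarrow> Cod A (Ident A X) = X"
    and Comp_in: "\<lbrakk>f \<in> Arr A; g \<in> Arr A; Cod A f = Dom A g\<rbrakk> \<Longrightarrow> Comp A f g \<in> Arr A"
    and Dom_Comp: "\<lbrakk>f \<in> Arr A; g \<in> Arr A; Cod A f = Dom A g\<rbrakk> \<Longrightarrow> Dom A (Comp A f g) = Dom A f"
    and Cod_Comp: "\<lbrakk>f \<in> Arr A; g \<in> Arr A; Cod A f = Dom A g\<rbrakk> \<Longrightarrow> Cod A (Comp A f g) = Cod A g"
    and Comp_assoc: "\<lbrakk>f \<in> Arr A; g \<in> Arr A; h \<in> Arr A; Cod A f = Dom A g; Cod A g = Dom A h\<rbrakk>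
      \<Longrightarrow> Comp A (Comp A f g) h = Comp A f (Comp A g h)"
    and Ident_left: "f \<in> Arr A \<Longrightarrow> Comp A (Ident A (Dom A f)) f = f"
    and Ident_right: "f \<in> Arr A \<Longrightarrow> Comp A f (Ident A (Cod A f)) = f"

locale is_functor =
  source: is_category A + target: is_category B
  for A :: "('o1, 'm1) cat" and B :: "('o2, 'm2) cat" +
  fixes Fo :: "'o1 \<Rightarrow> 'o2" and Fa :: "'m1 \<Rightarrow> 'm2"
  assumes Fo_in: "X \<in> Obj A \<Longrightarrow> Fo X \<in> Obj B"
    and Fa_in: "f \<in> Arr A \<Longrightarrow> Fa f \<in> Arr B"
    and Fa_Dom: "f \<in> Arr A \<Longrightarrow> Dom B (Fa f) = Fo (Dom A f)"
    and Fa_Cod: "f \<in> Arr A \<Longrightarrow> Cod B (Fa f) = Fo (Cod A f)"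
    and Fa_Ident: "X \<in> Obj A \<Longrightarrow> Fa (Ident A X) = Ident B (Fo X)"
    and Fa_Comp: "\<lbrakk>f \<in> Arr A; g \<in> Arr A; Cod A f = Dom A g\<rbrakk>
      \<Longrightarrow> Fa (Comp A f g) = Comp B (Fa f) (Fa g)"

definition isomorphic_categories :: "('o1, 'm1) cat \<Rightarrow> ('o2, 'm2) cat \<Rightarrow> bool" where
  "isomorphic_categories A B \<longleftrightarrow>
    is_category A \<and> is_category B \<and>
    (\<exists>Fo Fa Go Ga. is_functor A B Fo Fa \<and> is_functor B A Go Ga \<and>
      (\<forall>X \<in> Obj A. Go (Fo X) = X) \<and> (\<forall>f \<in> Arr A. Ga (Fa f) = f) \<and>
      (\<forall>Y \<in> Obj B. Fo (Go Y) = Y) \<and> (\<forall>g \<in> Arr B. Fa (Ga g) = g))"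

text \<open>The category with objects \<open>Obs\<close> whose arrows from \<open>S\<close> to \<open>T\<close> are the maps between the
  carriers that satisfy \<open>H S T\<close>. An arrow records its domain and codomain; its underlying map is
  extensional (\<open>undefined\<close> off the carrier), so that equality of arrows is equality of maps.\<close>

definition structure_category ::
    "'s set \<Rightarrow> ('s \<Rightarrow> 'a set) \<Rightarrow> ('s \<Rightarrow> 's \<Rightarrow> ('a \<Rightarrow> 'a) \<Rightarrow> bool) \<Rightarrow> ('s, 's \<times> ('a \<Rightarrow> 'a) \<times> 's) cat"
  where
  "structure_category Obs car H =
    \<lparr> Obj = Obs,
      Arr = {(S, \<phi>, T). S \<in> Obs \<and> T \<in> Obs \<and> \<phi> \<in> car S \<rightarrow>\<^sub>E car T \<and> H S T \<phi>},
      Dom = (\<lambda>(S, \<phi>, T). S),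
      Cod = (\<lambda>(S, \<phi>, T). T),
      Ident = (\<lambda>S. (S, restrict id (car S), S)),
      Comp = (\<lambda>(S, \<phi>, T) (T', \<psi>, U). (S, compose (car S) \<psi> \<phi>, U)) \<rparr>"


section \<open>DRC-restriction semigroups\<close>

text \<open>The unary operations usually written \<open>x\<^sup>+\<close> and \<open>x\<^sup>*\<close> are \<open>x\<^sup>\<oplus>\<close> and \<open>x\<^sup>\<star>\<close> here, since the former
  clash with the closures of relations.\<close>

locale drc_semigroup =
  fixes S :: "'a set"
    and mult :: "'a \<Rightarrow> 'a \<Rightarrow> 'a" (infixl "\<cdot>" 70)
    and plus :: "'a \<Rightarrow> 'a" ("_\<^sup>\<oplus>" [1000] 999)
    and ast :: "'a \<Rightarrow> 'a" ("_\<^sup>\<star>" [1000] 999)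
  assumes nonempty: "S \<noteq> {}"
    and mult_closed: "\<lbrakk>x \<in> S; y \<in> S\<rbrakk> \<Longrightarrow> x \<cdot> y \<in> S"
    and plus_closed: "x \<in> S \<Longrightarrow> x\<^sup>\<oplus> \<in> S"
    and ast_closed: "x \<in> S \<Longrightarrow> x\<^sup>\<star> \<in> S"
    and mult_assoc: "\<lbrakk>x \<in> S; y \<in> S; z \<in> S\<rbrakk> \<Longrightarrow> (x \<cdot> y) \<cdot> z = x \<cdot> (y \<cdot> z)"
    and plus_mult: "x \<in> S \<Longrightarrow> x\<^sup>\<oplus> \<cdot> x = x"
    and plus_cong: "\<lbrakk>x \<in> S; y \<in> S\<rbrakk> \<Longrightarrow> (x \<cdot> y)\<^sup>\<oplus> = (x \<cdot> y\<^sup>\<oplus>)\<^sup>\<oplus>"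
    and plus_le: "\<lbrakk>x \<in> S; y \<in> S\<rbrakk> \<Longrightarrow> (x \<cdot> y)\<^sup>\<oplus> = x\<^sup>\<oplus> \<cdot> (x \<cdot> y)\<^sup>\<oplus> \<cdot> x\<^sup>\<oplus>"
    and plus_plus: "x \<in> S \<Longrightarrow> (x\<^sup>\<oplus>)\<^sup>\<oplus> = x\<^sup>\<oplus>"
    and plus_ast: "x \<in> S \<Longrightarrow> (x\<^sup>\<oplus>)\<^sup>\<star> = x\<^sup>\<oplus>"
    and mult_ast: "x \<in> S \<Longrightarrow> x \<cdot> x\<^sup>\<star> = x"
    and ast_cong: "\<lbrakk>x \<in> S; y \<in> S\<rbrakk> \<Longrightarrow> (x \<cdot> y)\<^sup>\<star> = (x\<^sup>\<star> \<cdot> y)\<^sup>\<star>"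
    and ast_le: "\<lbrakk>x \<in> S; y \<in> S\<rbrakk> \<Longrightarrow> (x \<cdot> y)\<^sup>\<star> = y\<^sup>\<star> \<cdot> (x \<cdot> y)\<^sup>\<star> \<cdot> y\<^sup>\<star>"
    and ast_ast: "x \<in> S \<Longrightarrow> (x\<^sup>\<star>)\<^sup>\<star> = x\<^sup>\<star>"
    and ast_plus: "x \<in> S \<Longrightarrow> (x\<^sup>\<star>)\<^sup>\<oplus> = x\<^sup>\<star>"

locale drc_restriction_semigroup = drc_semigroup +
  assumes ast_restriction: "\<lbrakk>x \<in> S; y \<in> S\<rbrakk> \<Longrightarrow> x \<cdot> (y \<cdot> x)\<^sup>\<star> = (y \<cdot> x\<^sup>\<oplus>)\<^sup>\<star> \<cdot> x"
    and plus_restriction: "\<lbrakk>x \<in> S; y \<in> S\<rbrakk> \<Longrightarrow> (x \<cdot> y)\<^sup>\<oplus> \<cdot> x = x \<cdot> (x\<^sup>\<star> \<cdot> y)\<^sup>\<oplus>"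

record 'a drc =
  drc_carrier :: "'a set"
  drc_mult :: "'a \<Rightarrow> 'a \<Rightarrow> 'a"
  drc_plus :: "'a \<Rightarrow> 'a"
  drc_ast :: "'a \<Rightarrow> 'a"

text \<open>The operations are total functions in HOL. Requiring them to be \<open>undefined\<close> outside the
  carrier makes equality of records coincide with equality of structures.\<close>

definition extensional2 :: "'a set \<Rightarrow> ('a \<Rightarrow> 'a \<Rightarrow> 'a) \<Rightarrow> bool" where
  "extensional2 P f \<longleftrightarrow> (\<forall>x y. \<not> (x \<in> P \<and> y \<in> P) \<longrightarrow> f x y = undefined)"

definition drc_restriction_semigroups :: "'a drc set" where
  "drc_restriction_semigroups = {S.
    drc_restriction_semigroup (drc_carrier S) (drc_mult S) (drc_plus S) (drc_ast S) \<and>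
    extensional2 (drc_carrier S) (drc_mult S) \<and>
    drc_plus S \<in> extensional (drc_carrier S) \<and>
    drc_ast S \<in> extensional (drc_carrier S)}"

definition drc_hom :: "'a drc \<Rightarrow> 'a drc \<Rightarrow> ('a \<Rightarrow> 'a) \<Rightarrow> bool" where
  "drc_hom S T \<phi> \<longleftrightarrow>
    (\<forall>x \<in> drc_carrier S. \<forall>y \<in> drc_carrier S. \<phi> (drc_mult S x y) = drc_mult T (\<phi> x) (\<phi> y)) \<and>
    (\<forall>x \<in> drc_carrier S. \<phi> (drc_plus S x) = drc_plus T (\<phi> x)) \<and>
    (\<forall>x \<in> drc_carrier S. \<phi> (drc_ast S x) = drc_ast T (\<phi> x))"

definition DRC_category :: "('a drc, 'a drc \<times> ('a \<Rightarrow> 'a) \<times> 'a drc) cat" where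
  "DRC_category = structure_category drc_restriction_semigroups drc_carrier drc_hom"


section \<open>Projection algebras and paths\<close>

text \<open>The operations written \<open>\<times>\<close> and \<open>\<star>\<close> in the literature are \<open>\<otimes>\<close> and \<open>\<star>\<close> here.\<close>

locale projection_algebra =
  fixes P :: "'a set"
    and times :: "'a \<Rightarrow> 'a \<Rightarrow> 'a" (infixl "\<otimes>" 70)
    and star :: "'a \<Rightarrow> 'a \<Rightarrow> 'a" (infixl "\<star>" 70)
  assumes P_nonempty: "P \<noteq> {}"
    and times_closed: "\<lbrakk>e \<in> P; f \<in> P\<rbrakk> \<Longrightarrow> e \<otimes> f \<in> P"
    and star_closed: "\<lbrakk>e \<in> P; f \<in> P\<rbrakk> \<Longrightarrow> e \<star> f \<in> P"
    and L1: "e \<in> P \<Longrightarrow> e \<otimes> e = e"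
    and L2: "\<lbrakk>e \<in> P; f \<in> P\<rbrakk> \<Longrightarrow> (e \<otimes> f) \<otimes> e = e \<otimes> f"
    and L3: "\<lbrakk>e \<in> P; f \<in> P; g \<in> P\<rbrakk> \<Longrightarrow> e \<otimes> (f \<otimes> g) = (e \<otimes> f) \<otimes> (f \<otimes> g)"
    and L4: "\<lbrakk>e \<in> P; f \<in> P; g \<in> P\<rbrakk> \<Longrightarrow> (e \<otimes> f) \<otimes> g = (e \<otimes> f) \<otimes> (e \<otimes> g)"
    and R1: "e \<in> P \<Longrightarrow> e \<star> e = e"
    and R2: "\<lbrakk>e \<in> P; f \<in> P\<rbrakk> \<Longrightarrow> f \<star> e = e \<star> (f \<star> e)"
    and R3: "\<lbrakk>e \<in> P; f \<in> P; g \<in> P\<rbrakk> \<Longrightarrow> (g \<star> f) \<star> e = (g \<star> f) \<star> (f \<star> e)"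
    and R4: "\<lbrakk>e \<in> P; f \<in> P; g \<in> P\<rbrakk> \<Longrightarrow> g \<star> (f \<star> e) = (g \<star> e) \<star> (f \<star> e)"
    and P3_star: "\<lbrakk>e \<in> P; f \<in> P; g \<in> P\<rbrakk> \<Longrightarrow> (e \<star> (f \<otimes> g)) \<star> g = (e \<star> f) \<star> g"
    and P3_times: "\<lbrakk>e \<in> P; f \<in> P; g \<in> P\<rbrakk> \<Longrightarrow> g \<otimes> ((g \<star> f) \<otimes> e) = g \<otimes> (f \<otimes> e)"
    and P4_star: "\<lbrakk>e \<in> P; f \<in> P\<rbrakk> \<Longrightarrow> (e \<otimes> f) \<star> e = e \<otimes> f"
    and P4_times: "\<lbrakk>e \<in> P; f \<in> P\<rbrakk> \<Longrightarrow> f \<otimes> (e \<star> f) = e \<star> f"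
begin

definition nat_le :: "'a \<Rightarrow> 'a \<Rightarrow> bool" where
  "nat_le e f \<longleftrightarrow> e = f \<otimes> e"

definition friendly :: "'a \<Rightarrow> 'a \<Rightarrow> bool" where
  "friendly p q \<longleftrightarrow> p \<otimes> q = p \<and> p \<star> q = q"

definition paths :: "'a list set" where
  "paths = {ps. ps \<noteq> [] \<and> set ps \<subseteq> P \<and> successively friendly ps}"

primrec path_restr_tail :: "'a \<Rightarrow> 'a list \<Rightarrow> 'a list" where
  "path_restr_tail q [] = []"
| "path_restr_tail q (p # ps) = (q \<star> p) # path_restr_tail (q \<star> p) ps"

text \<open>Restriction to \<open>q\<close> of a path starting above \<open>q\<close>: \<open>q\<^sub>1 = q\<close> and \<open>q\<^sub>i = q\<^sub>i\<^sub>-\<^sub>1 \<star> p\<^sub>i\<close>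
  for \<open>i > 1\<close>.\<close>

definition path_restr :: "'a \<Rightarrow> 'a list \<Rightarrow> 'a list" where
  "path_restr q ps = q # path_restr_tail q (tl ps)"

definition path_le :: "'a list \<Rightarrow> 'a list \<Rightarrow> bool" where
  "path_le ps qs \<longleftrightarrow> (\<exists>r \<in> P. nat_le r (hd qs) \<and> ps = path_restr r qs)"

end

locale strong_projection_algebra = projection_algebra +
  assumes strong_times: "\<lbrakk>e \<in> P; f \<in> P; g \<in> P\<rbrakk>
      \<Longrightarrow> e \<otimes> (((e \<otimes> f) \<otimes> g) \<star> f) = (e \<otimes> f) \<otimes> g"
    and strong_star: "\<lbrakk>e \<in> P; f \<in> P; g \<in> P\<rbrakk>
      \<Longrightarrow> (f \<otimes> (g \<star> (f \<star> e))) \<star> e = g \<star> (f \<star> e)"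


section \<open>Chain projection ordered categories\<close>

text \<open>A small category given by its set \<open>C\<close> of morphisms. Only the values \<open>x \<circ> y\<close> with
  \<open>r x = d y\<close> are meaningful. Objects are identified with identities, so the set of objects
  is \<open>d ` C\<close>.\<close>

locale small_category =
  fixes C :: "'a set"
    and comp :: "'a \<Rightarrow> 'a \<Rightarrow> 'a" (infixl "\<odot>" 70)
    and d :: "'a \<Rightarrow> 'a"
    and r :: "'a \<Rightarrow> 'a"
  assumes C_nonempty: "C \<noteq> {}"
    and d_closed: "x \<in> C \<Longrightarrow> d x \<in> C"
    and r_closed: "x \<in> C \<Longrightarrow> r x \<in> C"
    and comp_closed: "\<lbrakk>x \<in> C; y \<in> C; r x = d y\<rbrakk> \<Longrightarrow> x \<odot> y \<in> C"
    and d_comp: "\<lbrakk>x \<in> C; y \<in> C; r x = d y\<rbrakk> \<Longrightarrow> d (x \<odot> y) = d x"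
    and r_comp: "\<lbrakk>x \<in> C; y \<in> C; r x = d y\<rbrakk> \<Longrightarrow> r (x \<odot> y) = r y"
    and comp_assoc: "\<lbrakk>x \<in> C; y \<in> C; z \<in> C; r x = d y; r y = d z\<rbrakk>
      \<Longrightarrow> (x \<odot> y) \<odot> z = x \<odot> (y \<odot> z)"
    and d_left: "x \<in> C \<Longrightarrow> r (d x) = d x \<and> d x \<odot> x = x"
    and r_right: "x \<in> C \<Longrightarrow> r x = d (r x) \<and> x \<odot> r x = x"

locale ordered_category = small_category C comp d r
  for C :: "'a set" and comp :: "'a \<Rightarrow> 'a \<Rightarrow> 'a" (infixl "\<odot>" 70) and d r +
  fixes le :: "'a rel"
  assumes le_partial_order: "partial_order_on C le"
    and O1: "(a, b) \<in> le \<Longrightarrow> (d a, d b) \<in> le \<and> (r a, r b) \<in> le"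
    and O2: "\<lbrakk>(a, b) \<in> le; (a', b') \<in> le; r a = d a'; r b = d b'\<rbrakk> \<Longrightarrow> (a \<odot> a', b \<odot> b') \<in> le"
    and O3: "\<lbrakk>a \<in> C; p \<in> d ` C; (p, d a) \<in> le\<rbrakk> \<Longrightarrow> \<exists>!u. (u, a) \<in> le \<and> d u = p"
    and O4: "\<lbrakk>a \<in> C; q \<in> d ` C; (q, r a) \<in> le\<rbrakk> \<Longrightarrow> \<exists>!v. (v, a) \<in> le \<and> r v = q"
begin

definition left_restr :: "'a \<Rightarrow> 'a \<Rightarrow> 'a" where
  "left_restr p a = (THE u. (u, a) \<in> le \<and> d u = p)"

definition right_restr :: "'a \<Rightarrow> 'a \<Rightarrow> 'a" where
  "right_restr a q = (THE v. (v, a) \<in> le \<and> r v = q)"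

definition down :: "'a \<Rightarrow> 'a set" where
  "down s = {x \<in> d ` C. (x, s) \<in> le}"

definition nu :: "'a \<Rightarrow> 'a \<Rightarrow> 'a" where
  "nu a p = r (left_restr p a)"

end

locale weak_projection_ordered_category =
  ordered_category C comp d r le + strong_projection_algebra "d ` C" times star
  for C :: "'a set" and comp :: "'a \<Rightarrow> 'a \<Rightarrow> 'a" (infixl "\<odot>" 70) and d r le
    and times :: "'a \<Rightarrow> 'a \<Rightarrow> 'a" (infixl "\<otimes>" 70)
    and star :: "'a \<Rightarrow> 'a \<Rightarrow> 'a" (infixl "\<star>" 70) +
  assumes le_iff_nat_le: "\<lbrakk>p \<in> d ` C; q \<in> d ` C\<rbrakk> \<Longrightarrow> (p, q) \<in> le \<longleftrightarrow> nat_le p q"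
begin

definition Theta :: "'a \<Rightarrow> 'a \<Rightarrow> 'a" where
  "Theta x a = r (left_restr (x \<star> d a) a)"

definition Delta :: "'a \<Rightarrow> 'a \<Rightarrow> 'a" where
  "Delta x a = d (right_restr a (r a \<otimes> x))"

definition linked :: "'a \<Rightarrow> 'a \<Rightarrow> 'a \<Rightarrow> bool" where
  "linked b e f \<longleftrightarrow> e \<in> d ` C \<and> f \<in> d ` C \<and> f = Theta e b \<star> f \<and> e = e \<otimes> Delta f b"

end

locale projection_ordered_category = weak_projection_ordered_category +
  assumes nu_maps: "a \<in> C \<Longrightarrow> nu a \<in> down (d a) \<rightarrow> down (r a)"
    and nu_times: "\<lbrakk>a \<in> C; p \<in> down (d a); q \<in> down (d a)\<rbrakk> \<Longrightarrow> nu a (p \<otimes> q) = nu a p \<otimes> nu a q"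
    and nu_star: "\<lbrakk>a \<in> C; p \<in> down (d a); q \<in> down (d a)\<rbrakk> \<Longrightarrow> nu a (p \<star> q) = nu a p \<star> nu a q"

locale chain_projection_ordered_category =
  projection_ordered_category C comp d r le times star
  for C :: "'a set" and comp :: "'a \<Rightarrow> 'a \<Rightarrow> 'a" (infixl "\<odot>" 70) and d r le
    and times :: "'a \<Rightarrow> 'a \<Rightarrow> 'a" (infixl "\<otimes>" 70)
    and star :: "'a \<Rightarrow> 'a \<Rightarrow> 'a" (infixl "\<star>" 70) +
  fixes \<epsilon> :: "'a list \<Rightarrow> 'a"
  assumes eval_closed: "ps \<in> paths \<Longrightarrow> \<epsilon> ps \<in> C"
    and E1: "p \<in> d ` C \<Longrightarrow> \<epsilon> [p] = p \<and> \<epsilon> [p, p] = p"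
    and E2: "ps \<in> paths \<Longrightarrow> d (\<epsilon> ps) = hd ps \<and> r (\<epsilon> ps) = last ps"
    and E3: "\<lbrakk>ps \<in> paths; qs \<in> paths; last ps = hd qs\<rbrakk> \<Longrightarrow> \<epsilon> (ps @ tl qs) = \<epsilon> ps \<odot> \<epsilon> qs"
    and E4: "\<lbrakk>ps \<in> paths; qs \<in> paths; path_le ps qs\<rbrakk> \<Longrightarrow> (\<epsilon> ps, \<epsilon> qs) \<in> le"
    and G2: "\<lbrakk>b \<in> C; linked b e f\<rbrakk> \<Longrightarrow>
      (let e1 = e \<star> d b; e2 = Delta f b; f1 = Theta e b; f2 = r b \<otimes> f in
        \<epsilon> [e, e1] \<odot> left_restr e1 b \<odot> \<epsilon> [f1, f] = \<epsilon> [e, e2] \<odot> left_restr e2 b \<odot> \<epsilon> [f2, f])"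

record 'a cpoc =
  cpoc_carrier :: "'a set"
  cpoc_comp :: "'a \<Rightarrow> 'a \<Rightarrow> 'a"
  cpoc_dom :: "'a \<Rightarrow> 'a"
  cpoc_ran :: "'a \<Rightarrow> 'a"
  cpoc_le :: "'a rel"
  cpoc_times :: "'a \<Rightarrow> 'a \<Rightarrow> 'a"
  cpoc_star :: "'a \<Rightarrow> 'a \<Rightarrow> 'a"
  cpoc_eval :: "'a list \<Rightarrow> 'a"

definition cpoc_objects :: "'a cpoc \<Rightarrow> 'a set" where
  "cpoc_objects K = cpoc_dom K ` cpoc_carrier K"

definition cpoc_paths :: "'a cpoc \<Rightarrow> 'a list set" where
  "cpoc_paths K = projection_algebra.paths (cpoc_objects K) (cpoc_times K) (cpoc_star K)"

text \<open>As for semigroups, every operation is \<open>undefined\<close> outside its domain of definition; for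
  \<open>\<circ>\<close> that domain is the set of composable pairs, so this is exactly a partial operation.\<close>

definition chain_projection_ordered_categories :: "'a cpoc set" where
  "chain_projection_ordered_categories = {K.
    chain_projection_ordered_category (cpoc_carrier K) (cpoc_comp K) (cpoc_dom K) (cpoc_ran K)
      (cpoc_le K) (cpoc_times K) (cpoc_star K) (cpoc_eval K) \<and>
    (\<forall>x y. \<not> (x \<in> cpoc_carrier K \<and> y \<in> cpoc_carrier K \<and> cpoc_ran K x = cpoc_dom K y)
      \<longrightarrow> cpoc_comp K x y = undefined) \<and>
    cpoc_dom K \<in> extensional (cpoc_carrier K) \<and>
    cpoc_ran K \<in> extensional (cpoc_carrier K) \<and>
    extensional2 (cpoc_objects K) (cpoc_times K) \<and>
    extensional2 (cpoc_objects K) (cpoc_star K) \<and>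
    cpoc_eval K \<in> extensional (cpoc_paths K)}"

definition cpoc_functor :: "'a cpoc \<Rightarrow> 'a cpoc \<Rightarrow> ('a \<Rightarrow> 'a) \<Rightarrow> bool" where
  "cpoc_functor K L \<phi> \<longleftrightarrow>
    (\<forall>a \<in> cpoc_carrier K. cpoc_dom L (\<phi> a) = \<phi> (cpoc_dom K a) \<and>
                          cpoc_ran L (\<phi> a) = \<phi> (cpoc_ran K a)) \<and>
    (\<forall>a \<in> cpoc_carrier K. \<forall>b \<in> cpoc_carrier K. cpoc_ran K a = cpoc_dom K b \<longrightarrow>
        \<phi> (cpoc_comp K a b) = cpoc_comp L (\<phi> a) (\<phi> b)) \<and>
    (\<forall>a b. (a, b) \<in> cpoc_le K \<longrightarrow> (\<phi> a, \<phi> b) \<in> cpoc_le L) \<and>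
    (\<forall>e \<in> cpoc_objects K. \<forall>f \<in> cpoc_objects K.
        \<phi> (cpoc_times K e f) = cpoc_times L (\<phi> e) (\<phi> f) \<and>
        \<phi> (cpoc_star K e f) = cpoc_star L (\<phi> e) (\<phi> f)) \<and>
    (\<forall>ps \<in> cpoc_paths K. \<phi> (cpoc_eval K ps) = cpoc_eval L (map \<phi> ps))"

definition CPOC_category :: "('a cpoc, 'a cpoc \<times> ('a \<Rightarrow> 'a) \<times> 'a cpoc) cat" where
  "CPOC_category = structure_category chain_projection_ordered_categories cpoc_carrier cpoc_functor"

end

theory Submission
  imports Defs
begin

text \<open>A DRC-restriction semigroup and a chain projection ordered category are two presentations of
  one structure on one set. In the semigroup, \<open>a\<^sup>\<oplus>\<close> and \<open>a\<^sup>\<star>\<close> are the domain and the range of \<open>a\<close>, a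
  composite is a product \<open>a \<cdot> b\<close> with \<open>a\<^sup>\<star> = b\<^sup>\<oplus>\<close>, the elements below \<open>a\<close> are the products
  \<open>p \<cdot> a\<close> with a projection \<open>p\<close> below \<open>a\<^sup>\<oplus>\<close>, the projections form a projection algebra under \<open>(e \<cdot> f)\<^sup>\<oplus>\<close> and \<open>(e \<cdot> f)\<^sup>\<star>\<close>, and a path
  is evaluated by multiplying its entries. Conversely, with \<open>e = (a\<^sup>\<star> \<cdot> b\<^sup>\<oplus>)\<^sup>\<oplus>\<close> and \<open>f = (a\<^sup>\<star> \<cdot> b\<^sup>\<oplus>)\<^sup>\<star>\<close>
  one has \<open>e \<cdot> f = a\<^sup>\<star> \<cdot> b\<^sup>\<oplus>\<close>, so that every product factors as
  \<open>a \<cdot> b = (a \<cdot> e) \<cdot> (e \<cdot> f) \<cdot> (f \<cdot> b)\<close>. The three factors are composable: they are a right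
  restriction of \<open>a\<close>, the value of the path \<open>(e, f)\<close>, and a left restriction of \<open>b\<close>. The same
  formula therefore recovers the product from the category, and it defines one in any chain
  projection ordered category.

  The crux is that this product is associative (\<open>product_assoc\<close>). Pushing the restriction by \<open>c\<close>
  through \<open>a \<cdot> b\<close>, and the restriction by \<open>a\<close> through \<open>b \<cdot> c\<close>, turns both bracketings into a
  composite of five factors. Because \<open>\<nu>\<^sub>b\<close> is a homomorphism of projection algebras, the two
  composites have the same first factor, whose range is now called \<open>e\<close>, and the same last factor,
  whose domain is now called \<open>f\<close>. The strongness axioms show that \<open>(e, f)\<close> is \<open>b\<close>-linked and that
  the three middle factors form
  \<open>\<lambda>(e, b, f)\<close> in one case and \<open>\<rho>(e, b, f)\<close> in the other, so that (G2) is precisely what is left.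
  In the other direction, both sides of (G2) evaluate to \<open>e \<cdot> b \<cdot> f\<close> in the semigroup
  (\<open>linked_lambda\<close>, \<open>linked_rho\<close>).

  Neither construction changes the underlying set, and an arrow of either category is determined by
  a map of sets. Hence it is enough that the constructions are mutually inverse and that a map is a
  homomorphism exactly when it is a functor (\<open>isomorphic_structure_categories\<close>).\<close>

section \<open>Isomorphisms of categories of structures\<close>

lemma is_category_structure_category:
  assumes H_id: "\<And>S. S \<in> Obs \<Longrightarrow> H S S (restrict id (car S))"
    and H_comp: "\<And>S T U \<phi> \<psi>. \<lbrakk>S \<in> Obs; T \<in> Obs; U \<in> Obs; \<phi> \<in> car S \<rightarrow>\<^sub>E car T; \<psi> \<in> car T \<rightarrow>\<^sub>E car U;
        H S T \<phi>; H T U \<psi>\<rbrakk> \<Longrightarrow> H S U (compose (car S) \<psi> \<phi>)"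
  shows "is_category (structure_category Obs car H)"
proof
  fix f g
  assume f: "f \<in> Arr (structure_category Obs car H)"
    and g: "g \<in> Arr (structure_category Obs car H)"
    and fg: "Cod (structure_category Obs car H) f = Dom (structure_category Obs car H) g"
  show "Comp (structure_category Obs car H) f g \<in> Arr (structure_category Obs car H)"
    using f g fg H_comp
    by (fastforce simp: structure_category_def compose_def)
qed (use H_id in \<open>auto simp: structure_category_def id_def PiE_def compose_Id Id_compose
       intro: compose_assoc\<close>)

text \<open>The functors in both directions act as the identity on underlying maps, so all functor laws
  reduce to the assumption that \<open>F\<close> preserves carriers and preserves and reflects admissible maps.\<close>

lemma isomorphic_structure_categories:
  fixes car1 :: "'s \<Rightarrow> 'a set" and car2 :: "'t \<Rightarrow> 'a set"
  assumes F: "\<And>S. S \<in> Obs1 \<Longrightarrow> F S \<in> Obs2" and G: "\<And>S. S \<in> Obs2 \<Longrightarrow> G S \<in> Obs1"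
    and GF: "\<And>S. S \<in> Obs1 \<Longrightarrow> G (F S) = S" and FG: "\<And>S. S \<in> Obs2 \<Longrightarrow> F (G S) = S"
    and car: "\<And>S. S \<in> Obs1 \<Longrightarrow> car2 (F S) = car1 S"
    and H: "\<And>S T \<phi>. \<lbrakk>S \<in> Obs1; T \<in> Obs1; \<phi> \<in> car1 S \<rightarrow>\<^sub>E car1 T\<rbrakk> \<Longrightarrow>
              H1 S T \<phi> \<longleftrightarrow> H2 (F S) (F T) \<phi>"
    and H1_id: "\<And>S. S \<in> Obs1 \<Longrightarrow> H1 S S (restrict id (car1 S))"
    and H1_comp: "\<And>S T U \<phi> \<psi>. \<lbrakk>S \<in> Obs1; T \<in> Obs1; U \<in> Obs1;
        \<phi> \<in> car1 S \<rightarrow>\<^sub>E car1 T; \<psi> \<in> car1 T \<rightarrow>\<^sub>E car1 U;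
        H1 S T \<phi>; H1 T U \<psi>\<rbrakk> \<Longrightarrow> H1 S U (compose (car1 S) \<psi> \<phi>)"
  shows "isomorphic_categories (structure_category Obs1 car1 H1) (structure_category Obs2 car2 H2)"
    (is "isomorphic_categories ?A ?B")
proof -
  have car': "car1 (G S) = car2 S" if "S \<in> Obs2" for S
    using that car[OF G] FG by metis
  have H': "H2 S T \<phi> \<longleftrightarrow> H1 (G S) (G T) \<phi>"
    if "S \<in> Obs2" "T \<in> Obs2" "\<phi> \<in> car2 S \<rightarrow>\<^sub>E car2 T" for S T \<phi>
    using that H[of "G S" "G T" \<phi>] by (simp add: G FG car')
  have A: "is_category ?A"
    using H1_id H1_comp by (rule is_category_structure_category)
  have B: "is_category ?B"
  proof (rule is_category_structure_category)
    show "H2 S S (restrict id (car2 S))" if "S \<in> Obs2" for S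
      using that H1_id[of "G S"] by (subst H') (auto simp: G car')
    show "H2 S U (compose (car2 S) \<psi> \<phi>)"
      if "S \<in> Obs2" "T \<in> Obs2" "U \<in> Obs2" "\<phi> \<in> car2 S \<rightarrow>\<^sub>E car2 T" "\<psi> \<in> car2 T \<rightarrow>\<^sub>E car2 U"
        "H2 S T \<phi>" "H2 T U \<psi>" for S T U \<phi> \<psi>
    proof -
      have "compose (car2 S) \<psi> \<phi> \<in> car2 S \<rightarrow>\<^sub>E car2 U"
        using that(4,5) by (auto simp: compose_def)
      moreover have "H1 (G S) (G U) (compose (car1 (G S)) \<psi> \<phi>)"
        using that by (intro H1_comp[where T = "G T"]) (simp_all add: G car' H')
      ultimately show ?thesis
        using that by (simp add: H' car')
    qed
  qed
  interpret A: is_category ?A by (rule A)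
  interpret B: is_category ?B by (rule B)
  let ?Fa = "\<lambda>(S, \<phi>, T). (F S, \<phi>, F T)" and ?Ga = "\<lambda>(S, \<phi>, T). (G S, \<phi>, G T)"
  have "is_functor ?A ?B F ?Fa"
    by unfold_locales (auto simp: structure_category_def F car H)
  moreover have "is_functor ?B ?A G ?Ga"
    by unfold_locales (auto simp: structure_category_def G car' H')
  moreover have "\<forall>S \<in> Obj ?A. G (F S) = S" "\<forall>f \<in> Arr ?A. ?Ga (?Fa f) = f"
    "\<forall>S \<in> Obj ?B. F (G S) = S" "\<forall>g \<in> Arr ?B. ?Fa (?Ga g) = g"
    by (auto simp: structure_category_def GF FG)
  ultimately show ?thesis
    unfolding isomorphic_categories_def using A B by blast
qed

section \<open>Projection algebras\<close>

context projection_algebra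
begin

lemma singleton_path: "[p] \<in> paths \<longleftrightarrow> p \<in> P"
  by (simp add: paths_def)

lemma Cons_path: "p # q # ps \<in> paths \<longleftrightarrow> p \<in> P \<and> friendly p q \<and> q # ps \<in> paths"
  by (auto simp: paths_def)

lemma times_le: "\<lbrakk>e \<in> P; f \<in> P\<rbrakk> \<Longrightarrow> nat_le (e \<otimes> f) e"
  using L3[of e e f] L4[of e e f] L1[of e] L1[of "e \<otimes> f"] times_closed[of e f]
  by (simp add: nat_le_def)

lemma star_le: "\<lbrakk>e \<in> P; f \<in> P\<rbrakk> \<Longrightarrow> nat_le (e \<star> f) f"
  by (simp add: nat_le_def P4_times)

text \<open>The relation \<open>nat_le\<close> is defined through \<open>\<otimes>\<close> only; the last three equations show that both
  operations, with either order of the arguments, describe the same order.\<close>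

lemma nat_leD:
  assumes "nat_le e f" "e \<in> P" "f \<in> P"
  shows "f \<otimes> e = e" "e \<star> f = e" "e \<otimes> f = e" "f \<star> e = e"
proof -
  show 1: "f \<otimes> e = e" using assms(1) by (simp add: nat_le_def)
  show 2: "e \<star> f = e" using P4_star[of f e] assms(2,3) 1 by simp
  show "e \<otimes> f = e" using L2[of f e] assms(2,3) 1 by simp
  show "f \<star> e = e" using R2[of f e] assms(2,3) 2 by simp
qed

text \<open>Below \<open>g\<close>, the element \<open>g \<star> h\<close> can replace \<open>h\<close> as a right argument of \<open>\<star>\<close>; the next lemma is
  the mirror image. They let one pass between the entries of a path \<open>(g \<otimes> h, g \<star> h)\<close> and the
  projections \<open>g\<close> and \<open>h\<close> that it comes from.\<close>

lemma star_star_le: "\<lbrakk>nat_le e g; e \<in> P; g \<in> P; h \<in> P\<rbrakk> \<Longrightarrow> e \<star> (g \<star> h) = e \<star> h"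
  using R3[of h g e] by (simp add: nat_leD)

lemma times_times_le: "\<lbrakk>nat_le e h; e \<in> P; g \<in> P; h \<in> P\<rbrakk> \<Longrightarrow> (g \<otimes> h) \<otimes> e = g \<otimes> e"
  using L3[of g h e] by (simp add: nat_leD)

lemma times_mono: "\<lbrakk>nat_le e h; e \<in> P; g \<in> P; h \<in> P\<rbrakk> \<Longrightarrow> nat_le (g \<otimes> e) (g \<otimes> h)"
  using L4[of g h e] by (simp add: nat_le_def[of "g \<otimes> e"] times_times_le)

lemma star_mono:
  assumes "nat_le e g" "e \<in> P" "g \<in> P" "h \<in> P"
  shows "nat_le (e \<star> h) (g \<star> h)"
  using star_le[of e "g \<star> h"] assms by (simp add: star_star_le star_closed)

text \<open>This is the path that links the two factors of a product, with \<open>g\<close> the range of the left factor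
  and \<open>h\<close> the domain of the right one.\<close>

lemma friendly_times_star:
  assumes "g \<in> P" "h \<in> P"
  shows "friendly (g \<otimes> h) (g \<star> h)"
proof -
  have le: "nat_le (g \<otimes> h) g" "nat_le (g \<star> h) h"
    using assms by (simp_all add: times_le star_le)
  note le1 = nat_leD[OF le(1) times_closed[OF assms] assms(1)]
    and le2 = nat_leD[OF le(2) star_closed[OF assms] assms(2)]
  have "(g \<otimes> h) \<star> (g \<star> h) = (g \<otimes> h) \<star> h"
    using assms le by (intro star_star_le) (simp_all add: times_closed)
  also have "\<dots> = g \<star> h"
    using P3_star[of g g h] assms le1 by (simp add: R1)
  finally have 1: "(g \<otimes> h) \<star> (g \<star> h) = g \<star> h" .
  have "(g \<otimes> h) \<otimes> (g \<star> h) = g \<otimes> (g \<star> h)"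
    using assms le by (intro times_times_le) (simp_all add: star_closed)
  also have "\<dots> = g \<otimes> h"
    using P3_times[of h h g] assms le2 by (simp add: L1)
  finally show ?thesis using 1 by (simp add: friendly_def)
qed

lemma pair_path: "[p, q] \<in> paths \<longleftrightarrow> p \<in> P \<and> q \<in> P \<and> friendly p q"
  by (simp add: Cons_path singleton_path) blast

end

context strong_projection_algebra
begin

text \<open>Restricting the path \<open>(g \<otimes> h, g \<star> h)\<close> to the range \<open>u\<close> should give a path from \<open>g \<otimes> u\<close> to \<open>u\<close>.
  The strongness axiom says that restricting back to the domain \<open>g \<otimes> u\<close> recovers \<open>u\<close>. Right
  restrictions of such paths are thereby expressed through left ones, for which the evaluation map
  is monotone.\<close>

lemma times_star_strong:
  assumes "nat_le u (g \<star> h)" "u \<in> P" "g \<in> P" "h \<in> P"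
  shows "(g \<otimes> u) \<star> h = u" and "friendly (g \<otimes> u) u"
proof -
  have u: "u \<star> (g \<star> h) = u"
    using assms by (simp add: nat_leD star_closed)
  show *: "(g \<otimes> u) \<star> h = u"
    using strong_star[of h g u] assms u by simp
  have e: "g \<otimes> u \<in> P" using assms by (simp add: times_closed)
  have "(g \<otimes> u) \<otimes> u = g \<otimes> u"
    using L4[of g u u] L1[OF e] assms by simp
  moreover have "(g \<otimes> u) \<star> u = u"
    using R4[of h "g \<otimes> u" "g \<otimes> u"] R1[of u] e * assms by simp
  ultimately show "friendly (g \<otimes> u) u"
    by (simp add: friendly_def)
qed

text \<open>The mirror image, for restrictions of \<open>(g \<otimes> h, g \<star> h)\<close> to the domain \<open>u\<close>.\<close>

lemma star_times_strong:
  assumes "nat_le u (g \<otimes> h)" "u \<in> P" "g \<in> P" "h \<in> P"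
  shows "g \<otimes> (u \<star> h) = u" and "friendly u (u \<star> h)"
proof -
  have u: "(g \<otimes> h) \<otimes> u = u"
    using assms by (simp add: nat_leD times_closed)
  show *: "g \<otimes> (u \<star> h) = u"
    using strong_times[of g h u] assms u by simp
  have e: "u \<star> h \<in> P" using assms by (simp add: star_closed)
  have "u \<star> (u \<star> h) = u \<star> h"
    using R4[of h u u] R1[OF e] assms by simp
  moreover have "u \<otimes> (u \<star> h) = u"
    using L4[of g "u \<star> h" "u \<star> h"] L1[of u] e * assms by simp
  ultimately show "friendly u (u \<star> h)"
    by (simp add: friendly_def)
qed

end

section \<open>The product in a chain projection ordered category\<close>

context ordered_category
begin

lemma objD: "p \<in> d ` C \<Longrightarrow> p \<in> C \<and> d p = p \<and> r p = p"
  using d_closed d_left r_right by (metis imageE)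

lemma d_obj: "x \<in> C \<Longrightarrow> d x \<in> d ` C"
  and r_obj: "x \<in> C \<Longrightarrow> r x \<in> d ` C"
  by (simp, metis r_closed r_right imageI)

lemma le_carrier: "(a, b) \<in> le \<Longrightarrow> a \<in> C \<and> b \<in> C"
  using le_partial_order by (auto simp: partial_order_on_def preorder_on_def)

lemma le_refl: "a \<in> C \<Longrightarrow> (a, a) \<in> le"
  using le_partial_order by (auto simp: partial_order_on_def preorder_on_def refl_on_def)

lemma le_trans: "\<lbrakk>(a, b) \<in> le; (b, c) \<in> le\<rbrakk> \<Longrightarrow> (a, c) \<in> le"
  using le_partial_order by (auto simp: partial_order_on_def preorder_on_def dest: transD)

lemma left_restr:
  assumes "a \<in> C" "p \<in> d ` C" "(p, d a) \<in> le"
  shows "left_restr p a \<in> C" "(left_restr p a, a) \<in> le" "d (left_restr p a) = p"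
  using theI'[OF O3[OF assms], folded left_restr_def] le_carrier by auto

lemma left_restr_unique: "(u, a) \<in> le \<Longrightarrow> left_restr (d u) a = u"
  unfolding left_restr_def
  by (rule the1_equality[OF O3]) (simp_all add: le_carrier d_obj O1)

lemma right_restr:
  assumes "a \<in> C" "q \<in> d ` C" "(q, r a) \<in> le"
  shows "right_restr a q \<in> C" "(right_restr a q, a) \<in> le" "r (right_restr a q) = q"
  using theI'[OF O4[OF assms], folded right_restr_def] le_carrier by auto

lemma right_restr_unique: "(v, a) \<in> le \<Longrightarrow> right_restr a (r v) = v"
  unfolding right_restr_def
  by (rule the1_equality[OF O4]) (simp_all add: le_carrier r_obj O1)

lemma left_restr_mono:
  assumes "a \<in> C" "p \<in> d ` C" "q \<in> d ` C" "(p, q) \<in> le" "(q, d a) \<in> le"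
  shows "(left_restr p a, left_restr q a) \<in> le"
proof -
  let ?q = "left_restr q a"
  have q: "?q \<in> C" "(?q, a) \<in> le" "d ?q = q"
    using assms by (simp_all add: left_restr)
  have p: "(left_restr p ?q, ?q) \<in> le" "d (left_restr p ?q) = p"
    using assms q by (simp_all add: left_restr)
  have "left_restr p a = left_restr p ?q"
    using left_restr_unique[OF le_trans[OF p(1) q(2)]] p(2) by simp
  then show ?thesis using p(1) by simp
qed

lemma right_restr_mono:
  assumes "a \<in> C" "p \<in> d ` C" "q \<in> d ` C" "(p, q) \<in> le" "(q, r a) \<in> le"
  shows "(right_restr a p, right_restr a q) \<in> le"
proof -
  let ?q = "right_restr a q"
  have q: "?q \<in> C" "(?q, a) \<in> le" "r ?q = q"
    using assms by (simp_all add: right_restr)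
  have p: "(right_restr ?q p, ?q) \<in> le" "r (right_restr ?q p) = p"
    using assms q by (simp_all add: right_restr)
  have "right_restr a p = right_restr ?q p"
    using right_restr_unique[OF le_trans[OF p(1) q(2)]] p(2) by simp
  then show ?thesis using p(1) by simp
qed

end

context chain_projection_ordered_category
begin

abbreviation obj :: "'a set" where
  "obj \<equiv> d ` C"

definition product :: "'a \<Rightarrow> 'a \<Rightarrow> 'a" where
  "product a b = (if a \<in> C \<and> b \<in> C
    then right_restr a (r a \<otimes> d b) \<odot> \<epsilon> [r a \<otimes> d b, r a \<star> d b] \<odot> left_restr (r a \<star> d b) b
    else undefined)"

lemma eval_pair:
  assumes "p \<in> obj" "q \<in> obj" "friendly p q"
  shows "\<epsilon> [p, q] \<in> C" "d (\<epsilon> [p, q]) = p" "r (\<epsilon> [p, q]) = q"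
  using eval_closed[of "[p, q]"] E2[of "[p, q]"] assms by (simp_all add: pair_path)

lemma eval_pair_mono:
  assumes "p \<in> obj" "q \<in> obj" "friendly p q" "u \<in> obj" "(u, p) \<in> le" "friendly u (u \<star> q)"
  shows "(\<epsilon> [u, u \<star> q], \<epsilon> [p, q]) \<in> le"
proof (rule E4)
  show "path_le [u, u \<star> q] [p, q]"
    using assms by (auto simp: path_le_def path_restr_def le_iff_nat_le)
qed (use assms in \<open>simp_all add: pair_path star_closed\<close>)

lemma product_parts:
  assumes "a \<in> C" "b \<in> C"
  shows "r a \<otimes> d b \<in> obj" "r a \<star> d b \<in> obj" "(r a \<otimes> d b, r a) \<in> le" "(r a \<star> d b, d b) \<in> le"
    "friendly (r a \<otimes> d b) (r a \<star> d b)"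
proof -
  have o: "r a \<in> obj" "d b \<in> obj" using assms by (simp_all add: r_obj)
  then show m: "r a \<otimes> d b \<in> obj" "r a \<star> d b \<in> obj"
    using times_closed star_closed by blast+
  show "(r a \<otimes> d b, r a) \<in> le" "(r a \<star> d b, d b) \<in> le"
    using m o by (simp_all add: le_iff_nat_le times_le star_le)
  show "friendly (r a \<otimes> d b) (r a \<star> d b)"
    using o by (rule friendly_times_star)
qed

lemma product:
  assumes "a \<in> C" "b \<in> C"
  shows "product a b \<in> C" "d (product a b) = d (right_restr a (r a \<otimes> d b))"
    "r (product a b) = nu b (r a \<star> d b)"
  using product_parts[OF assms] assms
  by (simp_all add: product_def nu_def comp_closed d_comp r_comp left_restr right_restr eval_pair)

lemma le_objD:
  assumes "p \<in> obj" "q \<in> obj" "(p, q) \<in> le"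
  shows "q \<otimes> p = p" "p \<star> q = p" "p \<otimes> q = p" "q \<star> p = p"
  using nat_leD[of p q] le_iff_nat_le[of p q] assms by simp_all

lemma product_object_left:
  assumes "p \<in> obj" "x \<in> C" "(p, d x) \<in> le"
  shows "product p x = left_restr p x"
proof -
  note p = objD[OF assms(1)] and le = le_objD[OF assms(1) d_obj[OF assms(2)] assms(3)]
  have "right_restr p p = p"
    using right_restr_unique[OF le_refl[of p]] p by simp
  then show ?thesis
    using p le assms E1[of p] r_right[of p] d_left[of "left_restr p x"]
    by (simp add: product_def left_restr)
qed

lemma product_object_right:
  assumes "q \<in> obj" "x \<in> C" "(q, r x) \<in> le"
  shows "product x q = right_restr x q"
proof -
  note q = objD[OF assms(1)] and le = le_objD[OF assms(1) r_obj[OF assms(2)] assms(3)]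
  have "left_restr q q = q"
    using left_restr_unique[OF le_refl[of q]] q by simp
  then show ?thesis
    using q le assms E1[of q] r_right[of "right_restr x q"]
    by (simp add: product_def right_restr)
qed

lemma product_composable:
  assumes "a \<in> C" "b \<in> C" "r a = d b"
  shows "product a b = a \<odot> b"
  using assms left_restr_unique[OF le_refl[of b]] right_restr_unique[OF le_refl[of a]]
    E1[of "d b"] L1[of "d b"] R1[of "d b"] r_right[of a]
  by (simp add: product_def r_obj)

text \<open>The last equation is what makes \<open>\<nu>\<close> invertible: a restriction of \<open>a\<close> is determined both by its
  domain and by its range.\<close>

lemma nu_obj:
  assumes "a \<in> C" "p \<in> obj" "(p, d a) \<in> le"
  shows "nu a p \<in> obj" "(nu a p, r a) \<in> le" "right_restr a (nu a p) = left_restr p a"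
  using left_restr[OF assms] O1[OF left_restr(2)[OF assms]]
    right_restr_unique[OF left_restr(2)[OF assms]]
  by (simp_all add: nu_def r_obj)

lemma nu_mono:
  assumes "a \<in> C" "p \<in> obj" "q \<in> obj" "(p, q) \<in> le" "(q, d a) \<in> le"
  shows "(nu a p, nu a q) \<in> le"
  using left_restr_mono[OF assms] O1 by (auto simp: nu_def)

text \<open>The right-hand side lies below the product factor by factor and has the right range, so it is the
  restriction by uniqueness.\<close>

lemma right_restr_product:
  assumes ab: "a \<in> C" "b \<in> C" and u: "u \<in> obj" "(u, r a \<star> d b) \<in> le"
  shows "right_restr (product a b) (nu b u)
    = right_restr a (r a \<otimes> u) \<odot> \<epsilon> [r a \<otimes> u, u] \<odot> left_restr u b" (is "_ = ?w")
proof -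
  note parts = product_parts[OF ab]
  have o: "r a \<in> obj" "d b \<in> obj" using ab by (simp_all add: r_obj)
  have udb: "(u, d b) \<in> le" using u(2) parts(4) by (rule le_trans)
  have e: "r a \<otimes> u \<in> obj" using o u by (intro times_closed)
  have e_le: "(r a \<otimes> u, r a \<otimes> d b) \<in> le"
    using o u udb e parts(1) times_mono[of u "d b" "r a"] by (simp add: le_iff_nat_le)
  have e_le': "(r a \<otimes> u, r a) \<in> le" using e_le parts(3) by (rule le_trans)
  have u': "nat_le u (r a \<star> d b)" using u parts(2) by (simp add: le_iff_nat_le)
  have "(r a \<otimes> u) \<star> (r a \<star> d b) = (r a \<otimes> u) \<star> d b"
    using star_star_le[of "r a \<otimes> u" "r a" "d b"] e e_le' o by (simp add: le_iff_nat_le)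
  also have "\<dots> = u" using times_star_strong(1)[OF u' u(1) o] .
  finally have eu: "(r a \<otimes> u) \<star> (r a \<star> d b) = u" .
  have fr: "friendly (r a \<otimes> u) u" using times_star_strong(2)[OF u' u(1) o] .
  have ev: "(\<epsilon> [r a \<otimes> u, u], \<epsilon> [r a \<otimes> d b, r a \<star> d b]) \<in> le"
    using eval_pair_mono[OF parts(1,2,5) e e_le] fr by (simp add: eu)
  have R: "(right_restr a (r a \<otimes> u), right_restr a (r a \<otimes> d b)) \<in> le"
    using right_restr_mono[OF ab(1) e parts(1) e_le parts(3)] .
  have L: "(left_restr u b, left_restr (r a \<star> d b) b) \<in> le"
    using left_restr_mono[OF ab(2) u(1) parts(2) u(2) parts(4)] .
  note eqs = left_restr[OF ab(2) u(1) udb] left_restr[OF ab(2) parts(2,4)]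
    right_restr[OF ab(1) e e_le'] right_restr[OF ab(1) parts(1,3)]
    eval_pair[OF e u(1) fr] eval_pair[OF parts(1,2,5)]
  have "(?w, product a b) \<in> le"
    unfolding product_def using ab by (simp, intro O2 R L ev) (simp_all add: eqs r_comp)
  moreover have "r ?w = nu b u"
    by (simp add: eqs r_comp comp_closed nu_def)
  ultimately show ?thesis
    using right_restr_unique by metis
qed

lemma left_restr_product:
  assumes bc: "b \<in> C" "c \<in> C" and v: "v \<in> obj" "(v, d b) \<in> le"
    and w: "(nu b v, r b \<otimes> d c) \<in> le"
  shows "left_restr v (product b c)
    = left_restr v b \<odot> \<epsilon> [nu b v, nu b v \<star> d c] \<odot> left_restr (nu b v \<star> d c) c" (is "_ = ?w")
proof -
  note parts = product_parts[OF bc]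
  define w where "w = nu b v"
  have o: "r b \<in> obj" "d c \<in> obj" using bc by (simp_all add: r_obj)
  have w: "w \<in> obj" "(w, r b) \<in> le" "right_restr b w = left_restr v b" "(w, r b \<otimes> d c) \<in> le"
    using nu_obj[OF bc(1) v] assms(5) by (simp_all add: w_def)
  have k: "w \<star> d c \<in> obj" using o w by (intro star_closed)
  have k_le: "(w \<star> d c, r b \<star> d c) \<in> le"
    using o w k parts(2) star_mono[of w "r b" "d c"] by (simp add: le_iff_nat_le)
  have k_le': "(w \<star> d c, d c) \<in> le" using k_le parts(4) by (rule le_trans)
  have w': "nat_le w (r b \<otimes> d c)" using w parts(1) by (simp add: le_iff_nat_le)
  have wk: "w \<star> (r b \<star> d c) = w \<star> d c"
    using star_star_le[of w "r b" "d c"] w o by (simp add: le_iff_nat_le)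
  have fr: "friendly w (w \<star> d c)" using star_times_strong(2)[OF w' w(1) o] .
  have ev: "(\<epsilon> [w, w \<star> d c], \<epsilon> [r b \<otimes> d c, r b \<star> d c]) \<in> le"
    using eval_pair_mono[OF parts(1,2,5) w(1,4)] fr by (simp add: wk)
  have R: "(left_restr v b, right_restr b (r b \<otimes> d c)) \<in> le"
    using right_restr_mono[OF bc(1) w(1) parts(1) w(4) parts(3)] w(3) by simp
  have L: "(left_restr (w \<star> d c) c, left_restr (r b \<star> d c) c) \<in> le"
    using left_restr_mono[OF bc(2) k parts(2) k_le parts(4)] .
  have rv: "r (left_restr v b) = w" by (simp add: w_def nu_def)
  note eqs = left_restr[OF bc(1) v] left_restr[OF bc(2) k k_le'] left_restr[OF bc(2) parts(2,4)]
    right_restr[OF bc(1) parts(1,3)] eval_pair[OF w(1) k fr] eval_pair[OF parts(1,2,5)] rv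
  have "(?w, product b c) \<in> le"
    unfolding product_def using bc by (simp, fold w_def, intro O2 R L ev) (simp_all add: eqs r_comp)
  moreover have "d ?w = v"
    by (fold w_def) (simp add: eqs r_comp d_comp comp_closed)
  ultimately show ?thesis
    using left_restr_unique by metis
qed

text \<open>The middle factors of \<open>(ab)c\<close> run through \<open>u = X \<otimes> Y\<close> and those of \<open>a(bc)\<close> through
  \<open>v = X \<star> Y\<close>, where \<open>X\<close> and \<open>Y\<close> are the projections below \<open>d b\<close> that \<open>a\<close> and \<open>c\<close> determine. The
  axioms (P3) show that both products begin with \<open>a\<close> restricted to the range \<open>e = r a \<otimes> Y\<close> and, after
  transport along \<open>\<nu>\<^sub>b\<close>, that both end with \<open>c\<close> restricted to the domain \<open>f\<close>.\<close>

lemma product_assoc: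
  assumes abc: "a \<in> C" "b \<in> C" "c \<in> C"
  shows "product (product a b) c = product a (product b c)"
proof -
  note ab = product_parts[OF abc(1,2)] and bc = product_parts[OF abc(2,3)]
  \<comment> \<open>Y is the preimage of \<open>r b \<otimes> d c\<close> under \<open>\<nu>\<^sub>b\<close>, that is, the domain of \<open>bc\<close>.\<close>
  define X Y where "X = r a \<star> d b" and "Y = d (right_restr b (r b \<otimes> d c))"
  have o: "r a \<in> obj" "d b \<in> obj" "r b \<in> obj" "d c \<in> obj" using abc by (simp_all add: r_obj)
  have X: "X \<in> obj" "(X, d b) \<in> le" using ab by (simp_all add: X_def)
  have Y: "Y \<in> obj" "(Y, d b) \<in> le" "nu b Y = r b \<otimes> d c"
  proof -
    note rr = right_restr[OF abc(2) bc(1,3)]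
    show "Y \<in> obj" "(Y, d b) \<in> le"
      using rr O1[OF rr(2)] by (simp_all add: Y_def)
    show "nu b Y = r b \<otimes> d c"
      using left_restr_unique[OF rr(2)] rr(3) by (simp add: nu_def Y_def)
  qed
  have down: "X \<in> down (d b)" "Y \<in> down (d b)" using X Y by (simp_all add: down_def)
  note nuX = nu_obj[OF abc(2) X]
  define u v where "u = X \<otimes> Y" and "v = X \<star> Y"
  have uX: "u \<in> obj" "(u, X) \<in> le" and vY: "v \<in> obj" "(v, Y) \<in> le"
    using X Y times_le[of X Y] star_le[of X Y] times_closed[of X Y] star_closed[of X Y]
    by (simp_all add: u_def v_def le_iff_nat_le)
  have u: "(u, d b) \<in> le" and v: "(v, d b) \<in> le"
    using uX vY X Y le_trans by blast+
  have nuu: "nu b u = nu b X \<otimes> d c"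
  proof -
    have "nu b u = nu b X \<otimes> (r b \<otimes> d c)"
      unfolding u_def using nu_times[OF abc(2) down] Y(3) by simp
    also have "\<dots> = (r b \<otimes> nu b X) \<otimes> (r b \<otimes> d c)"
      using le_objD(1)[OF nuX(1) o(3) nuX(2)] by simp
    also have "\<dots> = nu b X \<otimes> d c"
      using L4[of "r b" "nu b X" "d c"] le_objD(1)[OF nuX(1) o(3) nuX(2)] o nuX by simp
    finally show ?thesis .
  qed
  have rav: "r a \<star> Y = v"
    unfolding v_def X_def using R4[of "d b" Y "r a"] le_objD(2)[OF Y(1) o(2) Y(2)] o Y by simp
  have rau: "r a \<otimes> u = r a \<otimes> Y"
    unfolding u_def X_def
    using P3_times[of Y "d b" "r a"] le_objD(1)[OF Y(1) o(2) Y(2)] o Y by simp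
  have wY: "(nu b v, r b \<otimes> d c) \<in> le"
    using nu_mono[OF abc(2) vY(1) Y(1) vY(2) Y(2)] Y(3) by simp
  note nuv = nu_obj[OF abc(2) vY(1) v]
  define e f where "e = r a \<otimes> Y" and "f = nu b X \<star> d c"
  have e: "e \<in> obj" and f: "f \<in> obj"
    using o Y nuX by (simp_all add: e_def f_def times_closed star_closed)
  have f': "nu b v \<star> d c = f"
  proof -
    have "nu b v = nu b X \<star> (r b \<otimes> d c)"
      unfolding v_def using nu_star[OF abc(2) down] Y(3) by simp
    then have "nu b v \<star> d c = (nu b X \<star> r b) \<star> d c"
      using P3_star[of "nu b X" "r b" "d c"] o nuX by simp
    also have "nu b X \<star> r b = nu b X"
      using le_objD(2)[OF nuX(1) o(3) nuX(2)] .
    finally show ?thesis by (simp add: f_def)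
  qed
  have pab: "product a b \<in> C" "r (product a b) = nu b X" and pbc: "product b c \<in> C" "d (product b c) = Y"
    using product[OF abc(1,2)] product[OF abc(2,3)] by (simp_all add: X_def Y_def)
  \<comment> \<open>Strongness identifies \<open>u\<close> and \<open>v\<close> with the projections that occur in (G2) for \<open>(e, f)\<close>.\<close>
  have uX': "nat_le u (r a \<star> d b)" and wY': "nat_le (nu b v) (r b \<otimes> d c)"
    using uX X nuv wY bc(1) by (simp_all add: le_iff_nat_le flip: X_def)
  have fr1: "friendly e u" and eu: "e \<star> d b = u"
    using times_star_strong[OF uX' uX(1) o(1,2)] by (simp_all add: e_def rau)
  have fr2: "friendly (nu b u) f"
    using friendly_times_star[OF nuX(1) o(4)] by (simp add: nuu f_def)
  have fr3: "friendly e v"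
    using friendly_times_star[OF o(1) Y(1)] by (simp add: e_def rav)
  have fr4: "friendly (nu b v) f" and fv: "r b \<otimes> f = nu b v"
    using star_times_strong[OF wY' nuv(1) o(3,4)] by (simp_all add: f')
  have era: "(e, r a) \<in> le" and fdc: "(f, d c) \<in> le"
    using o e f Y nuX by (simp_all add: le_iff_nat_le times_le star_le e_def f_def)
  note nuu_obj = nu_obj[OF abc(2) uX(1) u]
  have Th: "Theta e b = nu b u"
    by (simp add: Theta_def eu nu_def)
  have De: "Delta f b = v"
    using nuv(3) left_restr(3)[OF abc(2) vY(1) v] by (simp add: Delta_def fv)
  have "linked b e f"
    using e f fr2 fr3 by (simp add: linked_def Th De friendly_def)
  from G2[OF abc(2) this]
  have G: "\<epsilon> [e, u] \<odot> left_restr u b \<odot> \<epsilon> [nu b u, f] = \<epsilon> [e, v] \<odot> left_restr v b \<odot> \<epsilon> [nu b v, f]"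
    by (simp add: Let_def eu Th De fv)
  define A F where "A = right_restr a e" and "F = left_restr f c"
  define B1 B2 where "B1 = left_restr u b" and "B2 = left_restr v b"
  note defs = A_def [symmetric] F_def [symmetric] B1_def [symmetric] B2_def [symmetric]
  have A: "A \<in> C" "r A = e" and F: "F \<in> C" "d F = f"
    using right_restr[OF abc(1) e era] left_restr[OF abc(3) f fdc] by (simp_all add: A_def F_def)
  have B: "B1 \<in> C" "d B1 = u" "r B1 = nu b u" "B2 \<in> C" "d B2 = v" "r B2 = nu b v"
    using left_restr[OF abc(2) uX(1) u] left_restr[OF abc(2) vY(1) v]
    by (simp_all add: B1_def B2_def nu_def)
  note ev = eval_pair[OF e uX(1) fr1] eval_pair[OF nuu_obj(1) f fr2]
    eval_pair[OF e vY(1) fr3] eval_pair[OF nuv(1) f fr4]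
  note simps = A F B ev comp_closed d_comp r_comp
  have "product (product a b) c = right_restr (product a b) (nu b u) \<odot> \<epsilon> [nu b u, f] \<odot> F"
    using pab abc by (simp add: product_def[of "product a b"] nuu f_def F_def)
  also have "right_restr (product a b) (nu b u) = A \<odot> \<epsilon> [e, u] \<odot> B1"
    using right_restr_product[OF abc(1,2) uX(1)] uX(2)
    by (simp add: A_def B1_def e_def rau flip: X_def)
  also have "A \<odot> \<epsilon> [e, u] \<odot> B1 \<odot> \<epsilon> [nu b u, f] \<odot> F = A \<odot> (\<epsilon> [e, u] \<odot> B1 \<odot> \<epsilon> [nu b u, f]) \<odot> F"
    by (simp add: simps comp_assoc)
  also have "\<dots> = A \<odot> (\<epsilon> [e, v] \<odot> B2 \<odot> \<epsilon> [nu b v, f]) \<odot> F"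
    using G by (simp add: defs)
  also have "\<dots> = A \<odot> \<epsilon> [e, v] \<odot> (B2 \<odot> \<epsilon> [nu b v, f] \<odot> F)"
    by (simp add: simps comp_assoc)
  also have "B2 \<odot> \<epsilon> [nu b v, f] \<odot> F = left_restr v (product b c)"
    using left_restr_product[OF abc(2,3) vY(1) v wY] by (simp add: f' B2_def F_def)
  also have "A \<odot> \<epsilon> [e, v] \<odot> left_restr v (product b c) = product a (product b c)"
    using pbc abc by (simp add: product_def[of a "product b c"] rav A_def e_def)
  finally show ?thesis .
qed

text \<open>Apart from associativity the axioms are quick: multiplying by a projection below the domain or
  the range is restriction, and the two restriction laws say that a left restriction of \<open>x\<close> is also
  the right restriction of \<open>x\<close> to its range.\<close>

lemma drc_restriction_semigroup_product: "drc_restriction_semigroup C product d r"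
proof
  show "C \<noteq> {}" by (rule C_nonempty)
next
  fix x y z assume xyz: "x \<in> C" "y \<in> C" "z \<in> C"
  then show "product (product x y) z = product x (product y z)" by (rule product_assoc)
next
  fix x y assume xy: "x \<in> C" "y \<in> C"
  note parts = product_parts[OF xy] product_parts[OF xy(2,1)]
  show "product x y \<in> C" using xy by (rule product)
  have dy: "d (d y) = d y" "d y \<in> C" "r (r x) = r x" "r x \<in> C"
    using objD[OF d_obj[OF xy(2)]] objD[OF r_obj[OF xy(1)]] by simp_all
  show "d (product x y) = d (product x (d y))"
    using xy dy by (simp add: product)
  show "r (product x y) = r (product (r x) y)"
    using xy dy by (simp add: product)
  have z: "d (product x y) \<in> obj" "(d (product x y), d x) \<in> le"
    using right_restr[OF xy(1) parts(1,3)] O1 by (auto simp: product[OF xy])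
  then show "d (product x y) = product (product (d x) (d (product x y))) (d x)"
    using product_object_right[of "d (product x y)" "d x"] product_object_left[of "d (product x y)" "d x"]
      objD[OF z(1)] objD[OF d_obj[OF xy(1)]] right_restr_unique[OF z(2)] left_restr_unique[OF z(2)]
    by simp
  have z: "r (product x y) \<in> obj" "(r (product x y), r y) \<in> le"
    using nu_obj[OF xy(2) parts(2,4)] by (simp_all add: product[OF xy])
  then show "r (product x y) = product (product (r y) (r (product x y))) (r y)"
    using product_object_right[of "r (product x y)" "r y"] product_object_left[of "r (product x y)" "r y"]
      objD[OF z(1)] objD[OF r_obj[OF xy(2)]] right_restr_unique[OF z(2)] left_restr_unique[OF z(2)]
    by simp
  show "product x (r (product y x)) = product (r (product y (d x))) x"
  proof -
    note p = parts(7,9)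
    have dx: "d x \<in> C" "d (d x) = d x" using objD[OF d_obj[OF xy(1)]] by simp_all
    have "left_restr (r y \<star> d x) (d x) = r y \<star> d x"
      using left_restr_unique[of "r y \<star> d x" "d x"] objD[OF p(1)] p(2) by simp
    then have "r (product y (d x)) = r y \<star> d x"
      using xy dx objD[OF p(1)] by (simp add: product nu_def)
    then show ?thesis
      using product_object_left[OF p(1) xy(1) p(2)] nu_obj[OF xy(1) p]
        product_object_right[of "nu x (r y \<star> d x)" x] xy by (simp add: product)
  qed
  show "product (d (product x y)) x = product x (d (product (r x) y))"
  proof -
    note p = parts(1,3)
    have "right_restr (r x) (r x \<otimes> d y) = r x \<otimes> d y"
      using right_restr_unique[of "r x \<otimes> d y" "r x"] objD[OF p(1)] p(2) by simp
    then have "d (product (r x) y) = r x \<otimes> d y"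
      using xy dy objD[OF p(1)] by (simp add: product)
    then show ?thesis
      using product_object_right[OF p(1) xy(1) p(2)] right_restr[OF xy(1) p]
        O1[OF right_restr(2)[OF xy(1) p]] left_restr_unique[OF right_restr(2)[OF xy(1) p]]
        product_object_left[of "d (right_restr x (r x \<otimes> d y))" x] xy by (simp add: product)
  qed
next
  fix x assume x: "x \<in> C"
  then show "d x \<in> C" "r x \<in> C" by (rule d_closed, rule r_closed)
  show "d (d x) = d x" "r (d x) = d x" "r (r x) = r x" "d (r x) = r x"
    using objD[OF d_obj[OF x]] objD[OF r_obj[OF x]] by simp_all
  show "product (d x) x = x"
    using product_composable[of "d x" x] objD[OF d_obj[OF x]] x d_left[of x] by simp
  show "product x (r x) = x"
    using product_composable[of x "r x"] objD[OF r_obj[OF x]] x r_right[of x] by simp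
qed

end

section \<open>Projections of a DRC-restriction semigroup\<close>

context drc_restriction_semigroup
begin

abbreviation proj :: "'a set" where
  "proj \<equiv> plus ` S"

lemma projD:
  assumes "p \<in> proj"
  shows "p \<in> S \<and> p\<^sup>\<oplus> = p \<and> p\<^sup>\<star> = p \<and> p \<cdot> p = p"
proof -
  obtain q where q: "q \<in> S" "p = q\<^sup>\<oplus>"
    using assms by (rule imageE) simp
  then show ?thesis
    using plus_mult[of p] by (simp add: plus_closed plus_plus plus_ast)
qed

lemma plus_proj: "x \<in> S \<Longrightarrow> x\<^sup>\<oplus> \<in> proj"
  by blast

lemma ast_proj: "x \<in> S \<Longrightarrow> x\<^sup>\<star> \<in> proj"
  using ast_plus[of x] ast_closed[of x] by (metis image_eqI)

lemma ast_image: "ast ` S = proj"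
proof
  show "proj \<subseteq> ast ` S"
  proof
    show "p \<in> ast ` S" if "p \<in> proj" for p
      using projD[OF that] by (intro image_eqI[of _ _ p]) simp_all
  qed
qed (rule image_subsetI, rule ast_proj)

lemma plus_idem: "x \<in> S \<Longrightarrow> x\<^sup>\<oplus> \<cdot> x\<^sup>\<oplus> = x\<^sup>\<oplus>"
  and ast_idem: "x \<in> S \<Longrightarrow> x\<^sup>\<star> \<cdot> x\<^sup>\<star> = x\<^sup>\<star>"
  using projD[OF plus_proj, of x] projD[OF ast_proj, of x] by simp_all

lemmas closed = mult_closed plus_closed ast_closed plus_proj ast_proj
lemmas unary_simps = plus_idem ast_idem plus_plus plus_ast ast_ast ast_plus plus_mult mult_ast

text \<open>Reversing the product exchanges the two unary operations. Each statement below whose mirror image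
  is needed is proved once and then read in the opposite semigroup; the interpretation is renewed
  whenever mirror images of newer facts are called for.\<close>

lemma dual: "drc_restriction_semigroup S (\<lambda>x y. y \<cdot> x) ast plus"
proof (unfold_locales, goal_cases)
  case (5 x y z)
  then show ?case by (simp add: mult_assoc)
next
  case (7 x y)
  then show ?case using ast_cong[of y x] by simp
next
  case (8 x y)
  then show ?case using ast_le[of y x] by (simp add: mult_closed ast_closed mult_assoc)
next
  case (12 x y)
  then show ?case using plus_cong[of y x] by simp
next
  case (13 x y)
  then show ?case using plus_le[of y x] by (simp add: mult_closed plus_closed mult_assoc)
next
  case (16 x y)
  then show ?case using plus_restriction[of x y] by simp
next
  case (17 x y)
  then show ?case using ast_restriction[of x y] by simp
qed (simp_all add: nonempty mult_closed plus_closed ast_closed plus_mult plus_plus plus_ast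
      mult_ast ast_ast ast_plus)

lemma plus_below:
  assumes "x \<in> S" "y \<in> S"
  shows "x\<^sup>\<oplus> \<cdot> (x \<cdot> y)\<^sup>\<oplus> = (x \<cdot> y)\<^sup>\<oplus>" and "(x \<cdot> y)\<^sup>\<oplus> \<cdot> x\<^sup>\<oplus> = (x \<cdot> y)\<^sup>\<oplus>"
proof -
  have xx: "x\<^sup>\<oplus> \<cdot> x\<^sup>\<oplus> = x\<^sup>\<oplus>" using assms(1) by (rule plus_idem)
  have e: "(x \<cdot> y)\<^sup>\<oplus> = x\<^sup>\<oplus> \<cdot> (x \<cdot> y)\<^sup>\<oplus> \<cdot> x\<^sup>\<oplus>" using assms by (rule plus_le)
  show "x\<^sup>\<oplus> \<cdot> (x \<cdot> y)\<^sup>\<oplus> = (x \<cdot> y)\<^sup>\<oplus>"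
    by (subst (1 2) e) (simp add: assms closed xx flip: mult_assoc)
  show "(x \<cdot> y)\<^sup>\<oplus> \<cdot> x\<^sup>\<oplus> = (x \<cdot> y)\<^sup>\<oplus>"
    by (subst (1 2) e) (simp add: assms closed xx mult_assoc)
qed

text \<open>The projection \<open>(e \<cdot> y)\<^sup>\<oplus>\<close> lies below \<open>e\<close>, so \<open>e\<close> can be inserted between it and \<open>y\<close>.\<close>

lemma plus_absorb:
  assumes "e \<in> proj" "y \<in> S"
  shows "(e \<cdot> y)\<^sup>\<oplus> \<cdot> y = e \<cdot> y"
proof -
  note [simp] = projD[OF assms(1)] assms(2)
  have "(e \<cdot> y)\<^sup>\<oplus> \<cdot> y = ((e \<cdot> y)\<^sup>\<oplus> \<cdot> e) \<cdot> y"
    using plus_below(2)[of e y] by simp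
  also have "\<dots> = (e \<cdot> y)\<^sup>\<oplus> \<cdot> (e \<cdot> y)"
    by (simp add: closed mult_assoc)
  also have "\<dots> = e \<cdot> y"
    by (simp add: closed plus_mult)
  finally show ?thesis .
qed

lemma plus_mult_mult:
  assumes "x \<in> S" "y \<in> S" "z \<in> S"
  shows "(x \<cdot> (y \<cdot> z)\<^sup>\<oplus>)\<^sup>\<oplus> = (x \<cdot> y \<cdot> z)\<^sup>\<oplus>"
  using assms plus_cong[of x "y \<cdot> z"] by (simp add: closed mult_assoc)

lemma proj_le_imp_commute:
  assumes "p \<in> proj" "q \<in> proj" "q \<cdot> p = p"
  shows "p \<cdot> q = p"
  using plus_below(2)[of q p] assms projD[OF assms(1)] projD[OF assms(2)] by simp

end

context drc_restriction_semigroup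
begin

interpretation dual: drc_restriction_semigroup S "\<lambda>x y. y \<cdot> x" ast plus
  rewrites "ast ` S = proj"
  by (rule dual) (rule ast_image)

lemmas ast_below = dual.plus_below
lemmas ast_absorb = dual.plus_absorb

lemmas proj_ge_imp_commute = dual.proj_le_imp_commute

text \<open>This factorization of a product of two projections makes the category remember the product: it is
  the value of the path from \<open>(e \<cdot> f)\<^sup>\<oplus>\<close> to \<open>(e \<cdot> f)\<^sup>\<star>\<close>.\<close>

lemma plus_ast_mult:
  assumes "e \<in> proj" "f \<in> proj"
  shows "(e \<cdot> f)\<^sup>\<oplus> \<cdot> (e \<cdot> f)\<^sup>\<star> = e \<cdot> f"
proof -
  note [simp] = projD[OF assms(1)] projD[OF assms(2)]
  have "e \<cdot> f = (e \<cdot> f)\<^sup>\<oplus> \<cdot> (e \<cdot> f)"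
    by (simp add: closed plus_mult)
  also have "\<dots> = (e \<cdot> f)\<^sup>\<oplus> \<cdot> (e \<cdot> (e \<cdot> f)\<^sup>\<star>)"
    using ast_absorb[OF assms(2), of e] by simp
  also have "\<dots> = ((e \<cdot> f)\<^sup>\<oplus> \<cdot> e) \<cdot> (e \<cdot> f)\<^sup>\<star>"
    by (simp add: closed mult_assoc)
  also have "(e \<cdot> f)\<^sup>\<oplus> \<cdot> e = (e \<cdot> f)\<^sup>\<oplus>"
    using plus_below(2)[of e f] by simp
  finally show ?thesis by simp
qed

section \<open>The chain projection ordered category of a DRC-restriction semigroup\<close>

definition ptimes :: "'a \<Rightarrow> 'a \<Rightarrow> 'a" where
  "ptimes e f = (if e \<in> proj \<and> f \<in> proj then (e \<cdot> f)\<^sup>\<oplus> else undefined)"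

definition pstar :: "'a \<Rightarrow> 'a \<Rightarrow> 'a" where
  "pstar e f = (if e \<in> proj \<and> f \<in> proj then (e \<cdot> f)\<^sup>\<star> else undefined)"

definition pcomp :: "'a \<Rightarrow> 'a \<Rightarrow> 'a" where
  "pcomp x y = (if x \<in> S \<and> y \<in> S \<and> x\<^sup>\<star> = y\<^sup>\<oplus> then x \<cdot> y else undefined)"

text \<open>An element below \<open>b\<close> is \<open>b\<close> multiplied on the left by a projection below \<open>b\<^sup>\<oplus>\<close>; that projection is
  then the domain of the element.\<close>

definition leq :: "'a rel" where
  "leq = {(a, b). a \<in> S \<and> b \<in> S \<and> a\<^sup>\<oplus> \<cdot> b = a \<and> b\<^sup>\<oplus> \<cdot> a\<^sup>\<oplus> = a\<^sup>\<oplus>}"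

text \<open>The recursion stops at the last entry instead of at a unit, since a DRC-restriction semigroup need
  not have an identity.\<close>

primrec path_product :: "'a list \<Rightarrow> 'a" where
  "path_product [] = undefined"
| "path_product (p # ps) = (if ps = [] then p else p \<cdot> path_product ps)"

definition peval :: "'a list \<Rightarrow> 'a" where
  "peval = restrict path_product (projection_algebra.paths proj ptimes pstar)"

lemma ptimes_eq: "\<lbrakk>e \<in> proj; f \<in> proj\<rbrakk> \<Longrightarrow> ptimes e f = (e \<cdot> f)\<^sup>\<oplus>"
  and pstar_eq: "\<lbrakk>e \<in> proj; f \<in> proj\<rbrakk> \<Longrightarrow> pstar e f = (e \<cdot> f)\<^sup>\<star>"
  and pcomp_eq: "\<lbrakk>x \<in> S; y \<in> S; x\<^sup>\<star> = y\<^sup>\<oplus>\<rbrakk> \<Longrightarrow> pcomp x y = x \<cdot> y"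
  by (simp_all add: ptimes_def pstar_def pcomp_def)

lemma ptimes_closed: "\<lbrakk>e \<in> proj; f \<in> proj\<rbrakk> \<Longrightarrow> ptimes e f \<in> proj"
  and pstar_closed: "\<lbrakk>e \<in> proj; f \<in> proj\<rbrakk> \<Longrightarrow> pstar e f \<in> proj"
  using projD[of e] projD[of f] by (simp_all add: ptimes_eq pstar_eq closed)

lemma ptimes_ptimes:
  assumes "e \<in> proj" "f \<in> proj" "g \<in> proj"
  shows "ptimes e (ptimes f g) = (e \<cdot> f \<cdot> g)\<^sup>\<oplus>" and "pstar e (ptimes f g) = (e \<cdot> (f \<cdot> g)\<^sup>\<oplus>)\<^sup>\<star>"
    and "pstar (pstar e f) g = (e \<cdot> f \<cdot> g)\<^sup>\<star>"
proof -
  note [simp] = projD[OF assms(1)] projD[OF assms(2)] projD[OF assms(3)]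
  show "ptimes e (ptimes f g) = (e \<cdot> f \<cdot> g)\<^sup>\<oplus>" "pstar e (ptimes f g) = (e \<cdot> (f \<cdot> g)\<^sup>\<oplus>)\<^sup>\<star>"
    "pstar (pstar e f) g = (e \<cdot> f \<cdot> g)\<^sup>\<star>"
    using assms plus_mult_mult[of e f g] dual.plus_mult_mult[of g f e]
    by (simp_all add: ptimes_eq pstar_eq closed mult_assoc)
qed

text \<open>The first strongness axiom, with \<open>h\<close> for an arbitrary element below \<open>ptimes e f\<close>. Since \<open>h \<le> e\<close>,
  one has \<open>h \<cdot> f = h \<cdot> (e \<cdot> f)\<close>, and a restriction law moves \<open>h\<close> across \<open>e \<cdot> f\<close>.\<close>

lemma plus_pstar_absorb:
  assumes "e \<in> proj" "f \<in> proj" "h \<in> proj" "ptimes (ptimes e f) h = h"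
  shows "ptimes e (pstar h f) = h"
proof -
  note [simp] = projD[OF assms(1)] projD[OF assms(2)] projD[OF assms(3)]
  have h1: "h = ((e \<cdot> f)\<^sup>\<oplus> \<cdot> h)\<^sup>\<oplus>" using assms by (simp add: ptimes_eq closed)
  have hef: "(e \<cdot> f)\<^sup>\<oplus> \<cdot> h = h"
    using plus_below(1)[of "(e \<cdot> f)\<^sup>\<oplus>" h] h1 by (simp add: closed unary_simps)
  have hef': "h \<cdot> (e \<cdot> f)\<^sup>\<oplus> = h"
    using hef assms by (intro proj_le_imp_commute) (simp_all add: closed)
  have he: "h \<cdot> e = h"
  proof -
    have "h \<cdot> e = h \<cdot> ((e \<cdot> f)\<^sup>\<oplus> \<cdot> e)"
      using hef' by (simp add: closed flip: mult_assoc)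
    also have "(e \<cdot> f)\<^sup>\<oplus> \<cdot> e = (e \<cdot> f)\<^sup>\<oplus>"
      using plus_below(2)[of e f] by simp
    finally show ?thesis using hef' by simp
  qed
  have hf: "h \<cdot> (e \<cdot> f) = h \<cdot> f"
    using he by (simp add: closed flip: mult_assoc)
  let ?k = "(h \<cdot> f)\<^sup>\<star>"
  have fk: "f \<cdot> ?k = ?k"
    using ast_below(2)[of f h] by simp
  have "e \<cdot> ?k = (e \<cdot> f) \<cdot> (h \<cdot> (e \<cdot> f))\<^sup>\<star>"
    using fk by (simp add: closed mult_assoc hf)
  also have "\<dots> = (h \<cdot> (e \<cdot> f)\<^sup>\<oplus>)\<^sup>\<star> \<cdot> (e \<cdot> f)"
    by (intro ast_restriction) (simp_all add: closed)
  also have "\<dots> = h \<cdot> (e \<cdot> f)"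
    using hef' by simp
  finally have "(e \<cdot> ?k)\<^sup>\<oplus> = (h \<cdot> (e \<cdot> f)\<^sup>\<oplus>)\<^sup>\<oplus>"
    using plus_cong[of h "e \<cdot> f"] by (simp add: closed)
  then show ?thesis using hef' assms by (simp add: ptimes_eq pstar_eq closed)
qed

lemma ptimes_idem: "e \<in> proj \<Longrightarrow> ptimes e e = e"
  using projD[of e] by (simp add: ptimes_eq)

lemma ptimes_left:
  assumes "e \<in> proj" "f \<in> proj"
  shows "e \<cdot> ptimes e f = ptimes e f" and "ptimes e f \<cdot> e = ptimes e f"
  using plus_below[of e f] projD[OF assms(1)] projD[OF assms(2)] assms by (simp_all add: ptimes_eq)

lemma ptimes_ptimes_left:
  assumes "e \<in> proj" "f \<in> proj"
  shows "ptimes (ptimes e f) e = ptimes e f" and "pstar (ptimes e f) e = ptimes e f"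
    and "ptimes e (ptimes e f) = ptimes e f"
proof -
  note [simp] = projD[OF assms(1)] projD[OF assms(2)] projD[OF ptimes_closed[OF assms]]
  show "ptimes (ptimes e f) e = ptimes e f" "pstar (ptimes e f) e = ptimes e f" "ptimes e (ptimes e f) = ptimes e f"
    using assms ptimes_left[OF assms] ptimes_closed[OF assms]
    by (simp_all add: ptimes_eq[of "ptimes e f" e] pstar_eq[of "ptimes e f" e] ptimes_eq[of e "ptimes e f"])
qed

lemma ptimes_ptimes_ptimes:
  assumes "e \<in> proj" "f \<in> proj" "g \<in> proj"
  shows "ptimes e (ptimes f g) = ptimes (ptimes e f) (ptimes f g)"
    and "ptimes (ptimes e f) g = ptimes (ptimes e f) (ptimes e g)"
    and "pstar (pstar e (ptimes f g)) g = pstar (pstar e f) g"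
proof -
  note [simp] = projD[OF assms(1)] projD[OF assms(2)] projD[OF assms(3)]
  note [simp] = projD[OF ptimes_closed[OF assms(1,2)]] projD[OF ptimes_closed[OF assms(2,3)]]
  have *: "ptimes e f \<cdot> f = e \<cdot> f" "ptimes f g \<cdot> g = f \<cdot> g"
    using plus_absorb[of e f] plus_absorb[of f g] assms by (simp_all add: ptimes_eq)
  show "ptimes e (ptimes f g) = ptimes (ptimes e f) (ptimes f g)"
    using assms by (simp add: ptimes_ptimes(1) ptimes_closed *)
  show "ptimes (ptimes e f) g = ptimes (ptimes e f) (ptimes e g)"
    using assms by (simp add: ptimes_ptimes(1) ptimes_closed ptimes_left ptimes_eq[of "ptimes e f" g])
  show "pstar (pstar e (ptimes f g)) g = pstar (pstar e f) g"
    using assms * by (simp add: ptimes_ptimes(3) ptimes_closed mult_assoc)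
qed

lemma ptimes_pstar_strong:
  assumes "e \<in> proj" "f \<in> proj" "g \<in> proj"
  shows "ptimes e (pstar (ptimes (ptimes e f) g) f) = ptimes (ptimes e f) g"
  using assms by (intro plus_pstar_absorb) (simp_all add: ptimes_closed ptimes_ptimes_left)

end

context drc_restriction_semigroup
begin

interpretation dual: drc_restriction_semigroup S "\<lambda>x y. y \<cdot> x" ast plus
  rewrites "ast ` S = proj"
  by (rule dual) (rule ast_image)

lemma dual_ops: "dual.ptimes e f = pstar f e" "dual.pstar e f = ptimes f e"
  by (auto simp: dual.ptimes_def dual.pstar_def pstar_def ptimes_def)

lemma strong_projection_algebra_proj: "strong_projection_algebra proj ptimes pstar"
proof
  fix e f g assume e: "e \<in> proj" and f: "f \<in> proj" and g: "g \<in> proj"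
  note d = dual.ptimes_ptimes_ptimes[OF e f g, unfolded dual_ops] dual.ptimes_pstar_strong[OF e f g, unfolded dual_ops]
  show "ptimes e (ptimes f g) = ptimes (ptimes e f) (ptimes f g)"
    "ptimes (ptimes e f) g = ptimes (ptimes e f) (ptimes e g)"
    "pstar (pstar e (ptimes f g)) g = pstar (pstar e f) g"
    using e f g by (rule ptimes_ptimes_ptimes)+
  show "ptimes e (pstar (ptimes (ptimes e f) g) f) = ptimes (ptimes e f) g"
    using e f g by (rule ptimes_pstar_strong)
  show "pstar (pstar g f) e = pstar (pstar g f) (pstar f e)" "pstar g (pstar f e) = pstar (pstar g e) (pstar f e)"
    "ptimes g (ptimes (pstar g f) e) = ptimes g (ptimes f e)"
    "pstar (ptimes f (pstar g (pstar f e))) e = pstar g (pstar f e)"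
    using d by simp_all
next
  fix e f assume e: "e \<in> proj" and f: "f \<in> proj"
  show "ptimes (ptimes e f) e = ptimes e f" "pstar (ptimes e f) e = ptimes e f"
    using e f by (rule ptimes_ptimes_left)+
  show "pstar f e = pstar e (pstar f e)" "ptimes f (pstar e f) = pstar e f"
    using dual.ptimes_ptimes_left[OF e f, unfolded dual_ops] dual.ptimes_ptimes_left[OF f e, unfolded dual_ops]
    by simp_all
  show "ptimes e f \<in> proj" "pstar e f \<in> proj"
    using e f by (rule ptimes_closed, rule pstar_closed)
next
  fix e assume e: "e \<in> proj"
  show "ptimes e e = e" "pstar e e = e"
    using ptimes_idem[OF e] dual.ptimes_idem[OF e] by (simp_all add: dual_ops)
qed (use nonempty in simp)

lemma restr_leq:
  assumes "p \<in> proj" "a \<in> S" "a\<^sup>\<oplus> \<cdot> p = p"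
  shows "(p \<cdot> a)\<^sup>\<oplus> = p" and "(p \<cdot> a, a) \<in> leq" and "a \<cdot> (p \<cdot> a)\<^sup>\<star> = p \<cdot> a"
proof -
  note [simp] = projD[OF assms(1)] assms(2)
  have [simp]: "p \<cdot> a\<^sup>\<oplus> = p"
    using assms plus_proj by (intro proj_le_imp_commute)
  show [simp]: "(p \<cdot> a)\<^sup>\<oplus> = p"
    using plus_cong[of p a] by simp
  show "(p \<cdot> a, a) \<in> leq"
    using assms(3) by (simp add: leq_def closed)
  show "a \<cdot> (p \<cdot> a)\<^sup>\<star> = p \<cdot> a"
    using ast_restriction[of a p] by simp
qed

lemma leq_eq: "(a, b) \<in> leq \<Longrightarrow> a = a\<^sup>\<oplus> \<cdot> b"
  by (simp add: leq_def)

text \<open>The order also has the mirror-image description by right multiplication, because a restriction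
  law turns \<open>p \<cdot> b\<close> into \<open>b \<cdot> (p \<cdot> b)\<^sup>\<star>\<close>.\<close>

lemma leq_ast:
  assumes "(a, b) \<in> leq"
  shows "b \<cdot> a\<^sup>\<star> = a \<and> a\<^sup>\<star> \<cdot> b\<^sup>\<star> = a\<^sup>\<star>"
proof -
  have a: "a \<in> S" "b \<in> S" "a\<^sup>\<oplus> \<cdot> b = a" "b\<^sup>\<oplus> \<cdot> a\<^sup>\<oplus> = a\<^sup>\<oplus>"
    using assms by (simp_all add: leq_def)
  show ?thesis
    using restr_leq(3)[of "a\<^sup>\<oplus>" b] ast_below(1)[of b "a\<^sup>\<oplus>"] a by (simp add: closed)
qed

end

context drc_restriction_semigroup
begin

interpretation dual: drc_restriction_semigroup S "\<lambda>x y. y \<cdot> x" ast plus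
  rewrites "ast ` S = proj"
  by (rule dual) (rule ast_image)

lemma dual_leq: "dual.leq = leq"
proof -
  have "(a, b) \<in> dual.leq" if "(a, b) \<in> leq" for a b
    using leq_ast[OF that] that by (simp add: leq_def dual.leq_def)
  moreover have "(a, b) \<in> leq" if "(a, b) \<in> dual.leq" for a b
    using dual.leq_ast[OF that] that by (simp add: leq_def dual.leq_def)
  ultimately show ?thesis by (intro subset_antisym subrelI)
qed

lemma right_restr_leq:
  assumes "q \<in> proj" "a \<in> S" "q \<cdot> a\<^sup>\<star> = q"
  shows "(a \<cdot> q)\<^sup>\<star> = q" and "(a \<cdot> q, a) \<in> leq" and "(a \<cdot> q)\<^sup>\<oplus> \<cdot> a = a \<cdot> q"
  using dual.restr_leq[OF assms] by (simp_all add: dual_leq)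

lemma leq_projI: "\<lbrakk>p \<in> proj; q \<in> proj; p \<cdot> q = p\<rbrakk> \<Longrightarrow> (p, q) \<in> leq"
  and leq_projD: "\<lbrakk>p \<in> proj; q \<in> proj; (p, q) \<in> leq\<rbrakk> \<Longrightarrow> p \<cdot> q = p"
  using projD[of p] projD[of q] proj_ge_imp_commute[of p q] by (simp_all add: leq_def)

lemma ordered_category_pcomp: "ordered_category S pcomp plus ast leq"
proof
  show "partial_order_on S leq"
  proof (unfold partial_order_on_def preorder_on_def, intro conjI)
    show "leq \<subseteq> S \<times> S" by (auto simp: leq_def)
    show "refl_on S leq" by (auto simp: leq_def refl_on_def unary_simps)
    show "antisym leq"
    proof (rule antisymI)
      fix a b assume ab: "(a, b) \<in> leq" "(b, a) \<in> leq"
      then have "a\<^sup>\<oplus> = b\<^sup>\<oplus>"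
        using proj_ge_imp_commute[of "a\<^sup>\<oplus>" "b\<^sup>\<oplus>"] proj_le_imp_commute[of "a\<^sup>\<oplus>" "b\<^sup>\<oplus>"]
        by (simp add: leq_def plus_proj)
      then show "a = b" using ab plus_mult[of b] by (simp add: leq_def)
    qed
    show "trans leq"
    proof (rule transI)
      fix a b c assume ab: "(a, b) \<in> leq" and bc: "(b, c) \<in> leq"
      have S: "a \<in> S" "b \<in> S" "c \<in> S" using ab bc by (simp_all add: leq_def)
      have e: "a\<^sup>\<oplus> \<cdot> b\<^sup>\<oplus> = a\<^sup>\<oplus>"
        using ab S by (intro proj_le_imp_commute) (simp_all add: closed leq_def)
      have "a\<^sup>\<oplus> \<cdot> c = a\<^sup>\<oplus> \<cdot> b\<^sup>\<oplus> \<cdot> c" using e by simp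
      also have "\<dots> = a" using ab bc S by (simp add: leq_def mult_assoc closed)
      finally have 1: "a\<^sup>\<oplus> \<cdot> c = a" .
      have "c\<^sup>\<oplus> \<cdot> a\<^sup>\<oplus> = c\<^sup>\<oplus> \<cdot> (b\<^sup>\<oplus> \<cdot> a\<^sup>\<oplus>)" using ab by (simp add: leq_def)
      also have "\<dots> = c\<^sup>\<oplus> \<cdot> b\<^sup>\<oplus> \<cdot> a\<^sup>\<oplus>" using S by (simp add: mult_assoc closed)
      also have "\<dots> = a\<^sup>\<oplus>" using ab bc by (simp add: leq_def)
      finally show "(a, c) \<in> leq" using 1 S by (simp add: leq_def)
    qed
  qed
next
  fix a b assume ab: "(a, b) \<in> leq"
  then have S: "a \<in> S" "b \<in> S" by (simp_all add: leq_def)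
  have "a\<^sup>\<oplus> \<cdot> b\<^sup>\<oplus> = a\<^sup>\<oplus>" "a\<^sup>\<star> \<cdot> b\<^sup>\<star> = a\<^sup>\<star>"
    using ab leq_ast[OF ab] S by (intro proj_le_imp_commute, simp_all add: closed leq_def)
  then show "(a\<^sup>\<oplus>, b\<^sup>\<oplus>) \<in> leq \<and> (a\<^sup>\<star>, b\<^sup>\<star>) \<in> leq"
    using S by (simp add: leq_projI closed)
next
  fix a b a' b' assume ab: "(a, b) \<in> leq" "(a', b') \<in> leq" "a\<^sup>\<star> = a'\<^sup>\<oplus>" "b\<^sup>\<star> = b'\<^sup>\<oplus>"
  then have S: "a \<in> S" "b \<in> S" "a' \<in> S" "b' \<in> S" by (simp_all add: leq_def)
  have pa: "(a \<cdot> a')\<^sup>\<oplus> = a\<^sup>\<oplus>" "(b \<cdot> b')\<^sup>\<oplus> = b\<^sup>\<oplus>"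
    using S ab plus_cong[of a a'] plus_cong[of b b'] mult_ast[of a] mult_ast[of b] by simp_all
  have "a \<cdot> a' = a \<cdot> (a'\<^sup>\<oplus> \<cdot> b')" using ab by (simp add: leq_def)
  also have "\<dots> = a \<cdot> a\<^sup>\<star> \<cdot> b'" using S ab by (simp add: mult_assoc closed)
  also have "\<dots> = a\<^sup>\<oplus> \<cdot> b \<cdot> b'" using S(1) ab(1) by (simp add: mult_ast leq_def)
  also have "\<dots> = a\<^sup>\<oplus> \<cdot> (b \<cdot> b')" using S by (simp add: mult_assoc closed)
  finally have "(a \<cdot> a', b \<cdot> b') \<in> leq"
    using S pa ab by (simp add: leq_def closed)
  then show "(pcomp a a', pcomp b b') \<in> leq"
    using S ab by (simp add: pcomp_eq)
next
  fix a p assume a: "a \<in> S" "p \<in> proj" "(p, a\<^sup>\<oplus>) \<in> leq"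
  then have "a\<^sup>\<oplus> \<cdot> p = p"
    using leq_projD[of p "a\<^sup>\<oplus>"] by (intro proj_ge_imp_commute) (simp_all add: plus_proj)
  then show "\<exists>!u. (u, a) \<in> leq \<and> u\<^sup>\<oplus> = p"
    using a restr_leq(1,2)[of p a] by (intro ex1I[of _ "p \<cdot> a"]) (simp, elim conjE, drule leq_eq, simp)
next
  fix a q assume a: "a \<in> S" "q \<in> proj" "(q, a\<^sup>\<star>) \<in> leq"
  then have "q \<cdot> a\<^sup>\<star> = q"
    using leq_projD[of q "a\<^sup>\<star>"] by (simp add: closed)
  then show "\<exists>!v. (v, a) \<in> leq \<and> v\<^sup>\<star> = q"
    using a right_restr_leq(1,2)[of q a]
    by (intro ex1I[of _ "a \<cdot> q"]) (simp, use leq_ast in fastforce)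
next
  fix x y assume xy: "x \<in> S" "y \<in> S" "x\<^sup>\<star> = y\<^sup>\<oplus>"
  then show "pcomp x y \<in> S" "(pcomp x y)\<^sup>\<oplus> = x\<^sup>\<oplus>" "(pcomp x y)\<^sup>\<star> = y\<^sup>\<star>"
    using plus_cong[of x y] ast_cong[of x y] mult_ast[of x] plus_mult[of y]
    by (simp_all add: pcomp_eq closed)
  fix z assume z: "z \<in> S" "y\<^sup>\<star> = z\<^sup>\<oplus>"
  have "(x \<cdot> y)\<^sup>\<star> = z\<^sup>\<oplus>" "x\<^sup>\<star> = (y \<cdot> z)\<^sup>\<oplus>"
    using xy z ast_cong[of x y] plus_cong[of y z] mult_ast[of y] plus_mult[of y] by simp_all
  then show "pcomp (pcomp x y) z = pcomp x (pcomp y z)"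
    using xy z by (simp add: pcomp_eq closed mult_assoc)
qed (simp_all add: nonempty closed unary_simps pcomp_eq)


text \<open>With \<open>p' = (p \<cdot> a)\<^sup>\<star>\<close> and \<open>q' = (q \<cdot> a)\<^sup>\<star>\<close> one has \<open>p \<cdot> a = a \<cdot> p'\<close> and \<open>q \<cdot> a = a \<cdot> q'\<close>, whence
  \<open>p \<cdot> q \<cdot> a = a \<cdot> p' \<cdot> q'\<close>; comparing ranges, and domains by a restriction law, gives the claim.\<close>

lemma nu_homomorphic:
  assumes "a \<in> S" "p \<in> proj" "q \<in> proj" "a\<^sup>\<oplus> \<cdot> p = p" "a\<^sup>\<oplus> \<cdot> q = q"
  shows "(ptimes p q \<cdot> a)\<^sup>\<star> = ptimes ((p \<cdot> a)\<^sup>\<star>) ((q \<cdot> a)\<^sup>\<star>)"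
    and "(pstar p q \<cdot> a)\<^sup>\<star> = pstar ((p \<cdot> a)\<^sup>\<star>) ((q \<cdot> a)\<^sup>\<star>)"
proof -
  note [simp] = projD[OF assms(2)] projD[OF assms(3)] assms(1)
  define p' q' where "p' = (p \<cdot> a)\<^sup>\<star>" and "q' = (q \<cdot> a)\<^sup>\<star>"
  have P: "p' \<in> proj" "q' \<in> proj" unfolding p'_def q'_def by (simp_all add: closed)
  note [simp] = projD[OF P(1)] projD[OF P(2)]
  have ap: "a \<cdot> p' = p \<cdot> a" and aq: "a \<cdot> q' = q \<cdot> a"
    unfolding p'_def q'_def using assms by (auto intro: restr_leq)
  have qa: "q \<cdot> a\<^sup>\<oplus> = q"
    using assms by (intro proj_le_imp_commute plus_proj)
  have p'a: "a\<^sup>\<star> \<cdot> p' = p'"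
    using ast_below(2)[of a p] unfolding p'_def by simp
  have pqa: "a \<cdot> (p' \<cdot> q') = p \<cdot> q \<cdot> a"
  proof -
    have "a \<cdot> (p' \<cdot> q') = a \<cdot> p' \<cdot> q'" by (simp add: mult_assoc)
    also have "\<dots> = p \<cdot> (a \<cdot> q')" by (simp add: ap mult_assoc)
    also have "\<dots> = p \<cdot> q \<cdot> a" by (simp add: aq mult_assoc)
    finally show ?thesis .
  qed
  have "(p \<cdot> q \<cdot> a)\<^sup>\<oplus> = (p \<cdot> q)\<^sup>\<oplus>"
    using plus_cong[of "p \<cdot> q" a] qa by (simp add: closed mult_assoc)
  then have *: "(p \<cdot> q)\<^sup>\<oplus> \<cdot> a = a \<cdot> (a\<^sup>\<star> \<cdot> (p' \<cdot> q'))\<^sup>\<oplus>"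
    using plus_restriction[of a "p' \<cdot> q'"] pqa by (simp add: closed)
  have a1: "a\<^sup>\<star> \<cdot> (p' \<cdot> q') = p' \<cdot> q'"
    using p'a by (simp add: closed flip: mult_assoc)
  have a2: "a\<^sup>\<star> \<cdot> (p' \<cdot> q')\<^sup>\<oplus> = (p' \<cdot> q')\<^sup>\<oplus>"
  proof -
    have "a\<^sup>\<star> \<cdot> (p' \<cdot> q')\<^sup>\<oplus> = a\<^sup>\<star> \<cdot> (p' \<cdot> (p' \<cdot> q')\<^sup>\<oplus>)"
      using plus_below(1)[of p' q'] by simp
    also have "\<dots> = a\<^sup>\<star> \<cdot> p' \<cdot> (p' \<cdot> q')\<^sup>\<oplus>"
      by (intro mult_assoc[symmetric]) (simp_all add: closed)
    also have "\<dots> = (p' \<cdot> q')\<^sup>\<oplus>"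
      unfolding p'a using plus_below(1)[of p' q'] by simp
    finally show ?thesis .
  qed
  have "((p \<cdot> q)\<^sup>\<oplus> \<cdot> a)\<^sup>\<star> = (a\<^sup>\<star> \<cdot> (p' \<cdot> q')\<^sup>\<oplus>)\<^sup>\<star>"
    using * a1 ast_cong[of a "(p' \<cdot> q')\<^sup>\<oplus>"] by (simp add: closed)
  also have "\<dots> = (p' \<cdot> q')\<^sup>\<oplus>"
    using a2 by (simp add: closed unary_simps)
  finally have "((p \<cdot> q)\<^sup>\<oplus> \<cdot> a)\<^sup>\<star> = (p' \<cdot> q')\<^sup>\<oplus>" .
  then show "(ptimes p q \<cdot> a)\<^sup>\<star> = ptimes ((p \<cdot> a)\<^sup>\<star>) ((q \<cdot> a)\<^sup>\<star>)"
    using assms P by (simp add: ptimes_eq flip: p'_def q'_def)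
  have "((p \<cdot> q)\<^sup>\<star> \<cdot> a)\<^sup>\<star> = (p \<cdot> q \<cdot> a)\<^sup>\<star>"
    using ast_cong[of "p \<cdot> q" a] by (simp add: closed)
  also have "p \<cdot> q \<cdot> a = p \<cdot> a \<cdot> q'"
    using aq by (simp add: closed mult_assoc)
  also have "(p \<cdot> a \<cdot> q')\<^sup>\<star> = (p' \<cdot> q')\<^sup>\<star>"
    using ast_cong[of "p \<cdot> a" q'] by (simp add: closed p'_def)
  finally show "(pstar p q \<cdot> a)\<^sup>\<star> = pstar ((p \<cdot> a)\<^sup>\<star>) ((q \<cdot> a)\<^sup>\<star>)"
    using assms P by (simp add: pstar_eq flip: p'_def q'_def)
qed

text \<open>For a \<open>b\<close>-linked pair \<open>(e, f)\<close>, the first five equations say that the factors of \<open>\<lambda>(e, b, f)\<close> are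
  composable, and the last one computes the composite: every inserted projection is absorbed by its
  neighbours. From \<open>e = (e \<cdot> b \<cdot> f)\<^sup>\<oplus>\<close> follow both \<open>e = (e \<cdot> b)\<^sup>\<oplus>\<close> and, by a restriction law,
  \<open>f1 = (f1 \<cdot> f)\<^sup>\<oplus>\<close>.\<close>

lemma linked_lambda:
  fixes b e f
  defines "e1 \<equiv> (e \<cdot> b\<^sup>\<oplus>)\<^sup>\<star>" and "f1 \<equiv> (e \<cdot> b)\<^sup>\<star>" and "e2 \<equiv> (b \<cdot> f)\<^sup>\<oplus>"
  assumes b: "b \<in> S" and e: "e \<in> proj" and f: "f \<in> proj"
    and linked: "(f1 \<cdot> f)\<^sup>\<star> = f" "(e \<cdot> e2)\<^sup>\<oplus> = e"
  shows "(e \<cdot> e1)\<^sup>\<oplus> = e" "(e \<cdot> e1)\<^sup>\<star> = e1" "(f1 \<cdot> f)\<^sup>\<oplus> = f1"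
    "b\<^sup>\<oplus> \<cdot> e1 = e1" "(e1 \<cdot> b)\<^sup>\<star> = f1" "e \<cdot> e1 \<cdot> (e1 \<cdot> b) \<cdot> (f1 \<cdot> f) = e \<cdot> b \<cdot> f"
proof -
  note [simp] = projD[OF e] projD[OF f] b
  have P: "e1 \<in> proj" "f1 \<in> proj"
    by (simp_all add: e1_def f1_def closed)
  note [simp] = projD[OF P(1)] projD[OF P(2)]
  have ee1: "e \<cdot> e1 = e \<cdot> b\<^sup>\<oplus>"
    unfolding e1_def using ast_absorb[of "b\<^sup>\<oplus>" e] by (simp add: closed)
  have ebf: "(e \<cdot> b \<cdot> f)\<^sup>\<oplus> = e"
    using linked(2) plus_mult_mult[of e b f] by (simp add: e2_def)
  have "e = (e \<cdot> b)\<^sup>\<oplus> \<cdot> e"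
    using plus_below(1)[of "e \<cdot> b" f] by (simp add: closed ebf)
  also have "\<dots> = (e \<cdot> b)\<^sup>\<oplus>"
    using plus_below(2)[of e b] by (simp add: closed)
  finally have eb: "(e \<cdot> b)\<^sup>\<oplus> = e" by simp
  show "(e \<cdot> e1)\<^sup>\<oplus> = e"
    using eb plus_cong[of e b] by (simp add: ee1)
  show "(e \<cdot> e1)\<^sup>\<star> = e1"
    using ee1 by (simp add: e1_def)
  show "b\<^sup>\<oplus> \<cdot> e1 = e1"
    unfolding e1_def using ast_below(2)[of "b\<^sup>\<oplus>" e] by (simp add: closed unary_simps)
  show "(e1 \<cdot> b)\<^sup>\<star> = f1"
    unfolding e1_def f1_def using ast_cong[of "e \<cdot> b\<^sup>\<oplus>" b] by (simp add: closed mult_assoc unary_simps)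
  have "e \<cdot> b = (e \<cdot> b \<cdot> f)\<^sup>\<oplus> \<cdot> (e \<cdot> b)"
    by (simp add: ebf closed flip: mult_assoc)
  also have "\<dots> = e \<cdot> b \<cdot> (f1 \<cdot> f)\<^sup>\<oplus>"
    using plus_restriction[of "e \<cdot> b" f] by (simp add: closed f1_def)
  finally have "f1 = (f1 \<cdot> (f1 \<cdot> f)\<^sup>\<oplus>)\<^sup>\<star>"
    using ast_cong[of "e \<cdot> b" "(f1 \<cdot> f)\<^sup>\<oplus>"] by (simp add: closed f1_def)
  also have "\<dots> = (f1 \<cdot> f)\<^sup>\<oplus>"
    using plus_below(1)[of f1 f] by (simp add: closed unary_simps)
  finally show "(f1 \<cdot> f)\<^sup>\<oplus> = f1" by simp
  have "e \<cdot> e1 \<cdot> (e1 \<cdot> b) \<cdot> (f1 \<cdot> f) = e \<cdot> e1 \<cdot> e1 \<cdot> b \<cdot> (f1 \<cdot> f)"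
    using mult_assoc[of "e \<cdot> e1" e1 b] by (simp add: closed)
  also have "e \<cdot> e1 \<cdot> e1 \<cdot> b = e \<cdot> e1 \<cdot> b"
    using mult_assoc[of e e1 e1] by simp
  also have "\<dots> = e \<cdot> b"
    by (simp add: ee1 closed mult_assoc unary_simps)
  also have "e \<cdot> b \<cdot> (f1 \<cdot> f) = e \<cdot> b \<cdot> f1 \<cdot> f"
    by (simp add: closed mult_assoc)
  also have "e \<cdot> b \<cdot> f1 = e \<cdot> b"
    unfolding f1_def by (intro mult_ast) (simp add: closed)
  finally show "e \<cdot> e1 \<cdot> (e1 \<cdot> b) \<cdot> (f1 \<cdot> f) = e \<cdot> b \<cdot> f" .
qed

end

context drc_restriction_semigroup
begin

interpretation dual: drc_restriction_semigroup S "\<lambda>x y. y \<cdot> x" ast plus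
  rewrites "ast ` S = proj"
  by (rule dual) (rule ast_image)

text \<open>In the opposite semigroup the pair \<open>(f, e)\<close> is \<open>b\<close>-linked and its \<open>\<lambda>\<close> is \<open>\<rho>(e, b, f)\<close>, with the
  middle factor written as \<open>b \<cdot> f2\<close> instead of \<open>e2 \<cdot> b\<close>.\<close>

lemma linked_rho:
  fixes b e f
  defines "f1 \<equiv> (e \<cdot> b)\<^sup>\<star>" and "e2 \<equiv> (b \<cdot> f)\<^sup>\<oplus>" and "f2 \<equiv> (b\<^sup>\<star> \<cdot> f)\<^sup>\<oplus>"
  assumes b: "b \<in> S" and e: "e \<in> proj" and f: "f \<in> proj"
    and linked: "(f1 \<cdot> f)\<^sup>\<star> = f" "(e \<cdot> e2)\<^sup>\<oplus> = e"
  shows "(f2 \<cdot> f)\<^sup>\<star> = f" "(f2 \<cdot> f)\<^sup>\<oplus> = f2" "(e \<cdot> e2)\<^sup>\<star> = e2"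
    "f2 \<cdot> b\<^sup>\<star> = f2" "e2 \<cdot> b = b \<cdot> f2" "(e2 \<cdot> b)\<^sup>\<star> = f2" "b\<^sup>\<oplus> \<cdot> e2 = e2"
    "e \<cdot> e2 \<cdot> (e2 \<cdot> b) \<cdot> (f2 \<cdot> f) = e \<cdot> b \<cdot> f"
proof -
  note [simp] = projD[OF e] projD[OF f] b
  note d = dual.linked_lambda[OF b f e, folded f1_def e2_def f2_def, OF linked(2,1)]
  show "(f2 \<cdot> f)\<^sup>\<star> = f" "(f2 \<cdot> f)\<^sup>\<oplus> = f2" "(e \<cdot> e2)\<^sup>\<star> = e2" and f2b: "f2 \<cdot> b\<^sup>\<star> = f2"
    using d by simp_all
  have P: "e2 \<in> proj" "f2 \<in> proj"
    by (simp_all add: e2_def f2_def closed)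
  note [simp] = projD[OF P(1)] projD[OF P(2)]
  show eb: "e2 \<cdot> b = b \<cdot> f2"
    unfolding e2_def f2_def by (intro plus_restriction) simp_all
  show "(e2 \<cdot> b)\<^sup>\<star> = f2"
    unfolding eb using right_restr_leq(1)[OF P(2) b f2b] .
  show "b\<^sup>\<oplus> \<cdot> e2 = e2"
    unfolding e2_def by (intro plus_below) simp_all
  show "e \<cdot> e2 \<cdot> (e2 \<cdot> b) \<cdot> (f2 \<cdot> f) = e \<cdot> b \<cdot> f"
    using d(6) unfolding eb by (simp add: closed mult_assoc)
qed

sublocale cat: ordered_category S pcomp plus ast leq
  by (rule ordered_category_pcomp)

sublocale alg: strong_projection_algebra proj ptimes pstar
  by (rule strong_projection_algebra_proj)

lemma nat_le_iff:
  assumes "p \<in> proj" "q \<in> proj"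
  shows "alg.nat_le p q \<longleftrightarrow> q \<cdot> p = p"
proof
  show "q \<cdot> p = p" if "alg.nat_le p q"
    using ptimes_left(1)[OF assms(2,1)] that[unfolded alg.nat_le_def, symmetric] by simp
  show "alg.nat_le p q" if "q \<cdot> p = p"
    using that projD[OF assms(1)] assms by (simp add: alg.nat_le_def ptimes_eq)
qed

lemma leq_iff_nat_le: "\<lbrakk>p \<in> proj; q \<in> proj\<rbrakk> \<Longrightarrow> (p, q) \<in> leq \<longleftrightarrow> alg.nat_le p q"
  using leq_projI[of p q] leq_projD[of p q] proj_le_imp_commute[of p q] proj_ge_imp_commute[of p q]
  unfolding nat_le_iff by metis

lemma left_restr_eq:
  assumes "p \<in> proj" "a \<in> S" "a\<^sup>\<oplus> \<cdot> p = p"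
  shows "cat.left_restr p a = p \<cdot> a"
  unfolding cat.left_restr_def
  by (rule the_equality) (use restr_leq[OF assms] in simp, elim conjE, drule leq_eq, simp)

lemma right_restr_eq:
  assumes "q \<in> proj" "a \<in> S" "q \<cdot> a\<^sup>\<star> = q"
  shows "cat.right_restr a q = a \<cdot> q"
  unfolding cat.right_restr_def
  by (rule the_equality) (use right_restr_leq[OF assms] in simp, use leq_ast in fastforce)

lemma mem_down:
  assumes "q \<in> proj"
  shows "p \<in> cat.down q \<longleftrightarrow> p \<in> proj \<and> q \<cdot> p = p"
  using assms leq_iff_nat_le[of p q] nat_le_iff[of p q] by (auto simp: cat.down_def)

sublocale wpoc: weak_projection_ordered_category S pcomp plus ast leq ptimes pstar
  by unfold_locales (rule leq_iff_nat_le)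

lemma Theta_eq:
  assumes "e \<in> proj" "b \<in> S"
  shows "wpoc.Theta e b = (e \<cdot> b)\<^sup>\<star>"
proof -
  note [simp] = projD[OF assms(1)] assms(2)
  have "b\<^sup>\<oplus> \<cdot> (e \<cdot> b\<^sup>\<oplus>)\<^sup>\<star> = (e \<cdot> b\<^sup>\<oplus>)\<^sup>\<star>"
    using ast_below(2)[of "b\<^sup>\<oplus>" e] by (simp add: closed unary_simps)
  moreover have "((e \<cdot> b\<^sup>\<oplus>)\<^sup>\<star> \<cdot> b)\<^sup>\<star> = (e \<cdot> b)\<^sup>\<star>"
    using ast_cong[of "e \<cdot> b\<^sup>\<oplus>" b] by (simp add: closed mult_assoc unary_simps)
  ultimately show ?thesis
    using assms by (simp add: wpoc.Theta_def pstar_eq left_restr_eq closed)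
qed

lemma Delta_eq:
  assumes "f \<in> proj" "b \<in> S"
  shows "wpoc.Delta f b = (b \<cdot> f)\<^sup>\<oplus>"
proof -
  note [simp] = projD[OF assms(1)] assms(2)
  have "(b\<^sup>\<star> \<cdot> f)\<^sup>\<oplus> \<cdot> b\<^sup>\<star> = (b\<^sup>\<star> \<cdot> f)\<^sup>\<oplus>"
    using plus_below(2)[of "b\<^sup>\<star>" f] by (simp add: closed unary_simps)
  moreover have "(b \<cdot> (b\<^sup>\<star> \<cdot> f)\<^sup>\<oplus>)\<^sup>\<oplus> = (b \<cdot> f)\<^sup>\<oplus>"
    using plus_mult_mult[of b "b\<^sup>\<star>" f] by (simp add: closed unary_simps)
  ultimately show ?thesis
    using assms by (simp add: wpoc.Delta_def ptimes_eq right_restr_eq closed)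
qed

sublocale poc: projection_ordered_category S pcomp plus ast leq ptimes pstar
proof
  fix a assume a: "a \<in> S"
  have nu: "cat.nu a p = (p \<cdot> a)\<^sup>\<star>" if "p \<in> cat.down (a\<^sup>\<oplus>)" for p
    using that a by (simp add: cat.nu_def left_restr_eq mem_down plus_proj)
  show "cat.nu a \<in> cat.down (a\<^sup>\<oplus>) \<rightarrow> cat.down (a\<^sup>\<star>)"
  proof
    fix p assume p: "p \<in> cat.down (a\<^sup>\<oplus>)"
    then have "p \<in> S" using a projD[of p] by (simp add: mem_down plus_proj)
    then show "cat.nu a p \<in> cat.down (a\<^sup>\<star>)"
      using a nu[OF p] ast_below(2)[of a p] by (simp add: mem_down closed)
  qed
  fix p q assume p: "p \<in> cat.down (a\<^sup>\<oplus>)" and q: "q \<in> cat.down (a\<^sup>\<oplus>)"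
  have P: "p \<in> proj" "a\<^sup>\<oplus> \<cdot> p = p" "q \<in> proj" "a\<^sup>\<oplus> \<cdot> q = q"
    using p q a by (simp_all add: mem_down plus_proj)
  have S: "p \<in> S" "q \<in> S" using P projD by blast+
  have "a\<^sup>\<oplus> \<cdot> ptimes p q = a\<^sup>\<oplus> \<cdot> p \<cdot> ptimes p q"
    using P(1,3) S a ptimes_left(1)[of p q] projD[OF ptimes_closed[OF P(1,3)]] by (simp add: closed mult_assoc)
  then have t: "ptimes p q \<in> cat.down (a\<^sup>\<oplus>)"
    using P ptimes_left(1)[of p q] a by (simp add: mem_down ptimes_closed plus_proj)
  have "a\<^sup>\<oplus> \<cdot> pstar p q = a\<^sup>\<oplus> \<cdot> q \<cdot> pstar p q"
    using P(1,3) S a dual.ptimes_left(2)[of q p] projD[OF pstar_closed[OF P(1,3)]]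
    by (simp add: closed mult_assoc dual.ptimes_eq pstar_eq)
  then have s: "pstar p q \<in> cat.down (a\<^sup>\<oplus>)"
    using P dual.ptimes_left(2)[of q p] a S
    by (simp add: mem_down closed dual.ptimes_eq pstar_eq)
  show "cat.nu a (ptimes p q) = ptimes (cat.nu a p) (cat.nu a q)"
    "cat.nu a (pstar p q) = pstar (cat.nu a p) (cat.nu a q)"
    unfolding nu[OF t] nu[OF s] nu[OF p] nu[OF q]
    using a P by (auto intro: nu_homomorphic)
qed

lemma path_product_Cons_path:
  assumes "p # ps \<in> alg.paths"
  shows "path_product (p # ps) \<in> S \<and> (path_product (p # ps))\<^sup>\<oplus> = p \<and> (path_product (p # ps))\<^sup>\<star> = last (p # ps)
    \<and> p \<cdot> path_product (p # ps) = path_product (p # ps)"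
  using assms
proof (induction ps arbitrary: p)
  case Nil
  then show ?case using projD[of p] by (simp add: alg.singleton_path)
next
  case (Cons q qs)
  then have p: "p \<in> proj" and pq: "alg.friendly p q" and qs: "q # qs \<in> alg.paths"
    by (simp_all add: alg.Cons_path)
  have q: "q \<in> proj" using qs by (simp add: alg.paths_def)
  note [simp] = projD[OF p] projD[OF q]
  define L where "L = path_product (q # qs)"
  have L: "L \<in> S" "L\<^sup>\<oplus> = q" "L\<^sup>\<star> = last (q # qs)" "q \<cdot> L = L"
    using Cons.IH[OF qs] by (simp_all add: L_def)
  have pq: "(p \<cdot> q)\<^sup>\<oplus> = p" "(p \<cdot> q)\<^sup>\<star> = q"
    using pq p q by (simp_all add: alg.friendly_def ptimes_eq pstar_eq)
  have "(p \<cdot> L)\<^sup>\<oplus> = p"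
    using plus_cong[of p L] L pq by simp
  moreover have "(p \<cdot> L)\<^sup>\<star> = last (q # qs)"
  proof -
    have "(p \<cdot> L)\<^sup>\<star> = (p \<cdot> q \<cdot> L)\<^sup>\<star>" using L by (simp add: mult_assoc)
    also have "\<dots> = L\<^sup>\<star>" using ast_cong[of "p \<cdot> q" L] L pq by (simp add: closed)
    finally show ?thesis using L by simp
  qed
  moreover have "p \<cdot> (p \<cdot> L) = p \<cdot> L"
    using L by (simp flip: mult_assoc)
  moreover have "path_product (p # q # qs) = p \<cdot> L" by (simp add: L_def)
  ultimately show ?case using L(1) by (simp add: closed)
qed

lemma path_product_append:
  assumes "ps \<in> alg.paths" "q # qs \<in> alg.paths" "last ps = q"
  shows "path_product (ps @ qs) = path_product ps \<cdot> path_product (q # qs)"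
proof -
  have Q: "q \<in> proj" using assms(2) by (simp add: alg.paths_def)
  note [simp] = projD[OF Q]
  define L where "L = path_product (q # qs)"
  have L: "L \<in> S" "q \<cdot> L = L"
    using path_product_Cons_path[OF assms(2)] by (simp_all add: L_def)
  have "path_product (p # ps @ qs) = path_product (p # ps) \<cdot> L" if "p # ps \<in> alg.paths" "last (p # ps) = q" for p ps
    using that
  proof (induction ps arbitrary: p)
    case Nil
    then show ?case using L by (cases qs) (simp_all add: L_def)
  next
    case (Cons p' ps)
    then have "p \<in> proj" "p' # ps \<in> alg.paths" by (simp_all add: alg.Cons_path)
    then show ?case
      using Cons path_product_Cons_path[of p' ps] projD[of p] L(1) by (simp add: mult_assoc)
  qed
  then show ?thesis
    using assms(1,3) by (cases ps) (simp_all add: alg.paths_def L_def)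
qed

text \<open>Each step uses \<open>q \<cdot> (q \<cdot> p')\<^sup>\<star> = q \<cdot> p'\<close>: the new entries of a restricted path are absorbed one
  after the other.\<close>

lemma path_product_path_restr:
  assumes "p # ps \<in> alg.paths" "q \<in> proj" "q \<cdot> p = q"
  shows "path_product (alg.path_restr q (p # ps)) = q \<cdot> path_product (p # ps)"
  using assms
proof (induction ps arbitrary: p q)
  case Nil
  then show ?case by (simp add: alg.path_restr_def)
next
  case (Cons p' ps)
  then have p: "p \<in> proj" and p's: "p' # ps \<in> alg.paths"
    by (simp_all add: alg.Cons_path)
  have p': "p' \<in> proj" using p's by (simp add: alg.paths_def)
  note [simp] = projD[OF p] projD[OF p'] projD[OF Cons.prems(2)]
  define q' where "q' = pstar q p'"
  have q': "q' \<in> proj" "q' \<cdot> p' = q'" "q \<cdot> q' = q \<cdot> p'"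
    using p' Cons.prems(2) ast_below(1)[of p' q] ast_absorb[of p' q]
    by (simp_all add: q'_def pstar_eq closed)
  note [simp] = projD[OF q'(1)]
  define L where "L = path_product (p' # ps)"
  have L: "L \<in> S" "p' \<cdot> L = L"
    using path_product_Cons_path[OF p's] by (simp_all add: L_def)
  have "path_product (alg.path_restr q (p # p' # ps)) = q \<cdot> path_product (alg.path_restr q' (p' # ps))"
    by (simp add: alg.path_restr_def q'_def)
  also have "\<dots> = q \<cdot> (q' \<cdot> L)"
    using Cons.IH[OF p's q'(1,2)] by (simp add: L_def)
  also have "\<dots> = q \<cdot> p' \<cdot> L"
    using L q' by (simp flip: mult_assoc)
  also have "\<dots> = q \<cdot> L"
    using L by (simp add: mult_assoc)
  also have "\<dots> = q \<cdot> p \<cdot> L"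
    using Cons.prems(3) by simp
  also have "\<dots> = q \<cdot> path_product (p # p' # ps)"
    using L by (simp add: mult_assoc L_def)
  finally show ?case .
qed

lemma peval_eq: "ps \<in> alg.paths \<Longrightarrow> peval ps = path_product ps"
  by (simp add: peval_def)

lemma peval_pair:
  assumes "p \<in> proj" "q \<in> proj" "(p \<cdot> q)\<^sup>\<oplus> = p" "(p \<cdot> q)\<^sup>\<star> = q"
  shows "peval [p, q] = p \<cdot> q"
  using assms by (simp add: peval_eq alg.pair_path alg.friendly_def ptimes_eq pstar_eq)

sublocale cpoc: chain_projection_ordered_category S pcomp plus ast leq ptimes pstar peval
proof
  fix ps assume "ps \<in> alg.paths"
  then show "peval ps \<in> S" "(peval ps)\<^sup>\<oplus> = hd ps \<and> (peval ps)\<^sup>\<star> = last ps"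
    using path_product_Cons_path[of "hd ps" "tl ps"] by (auto simp: peval_eq alg.paths_def)
next
  fix p assume p: "p \<in> proj"
  then show "peval [p] = p \<and> peval [p, p] = p"
    using projD[OF p] by (simp add: peval_pair peval_eq alg.singleton_path)
next
  fix ps qs assume ps: "ps \<in> alg.paths" and qs: "qs \<in> alg.paths" and pq: "last ps = hd qs"
  obtain q qs' where q: "qs = q # qs'" using qs by (cases qs) (auto simp: alg.paths_def)
  obtain p ps' where p: "ps = p # ps'" using ps by (cases ps) (auto simp: alg.paths_def)
  have "ps @ tl qs \<in> alg.paths"
    using ps qs pq unfolding q alg.paths_def
    by (cases qs') (auto simp: successively_append_iff)
  then show "peval (ps @ tl qs) = pcomp (peval ps) (peval qs)"
    using ps qs pq path_product_append[of ps q qs'] path_product_Cons_path[of q qs'] path_product_Cons_path[of p ps']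
    by (simp add: peval_eq q p pcomp_eq)
next
  fix ps qs assume ps: "ps \<in> alg.paths" and qs: "qs \<in> alg.paths" and "alg.path_le ps qs"
  then obtain q where q: "q \<in> proj" "alg.nat_le q (hd qs)" "ps = alg.path_restr q qs"
    by (auto simp: alg.path_le_def)
  obtain p qs' where p: "qs = p # qs'" using qs by (cases qs) (auto simp: alg.paths_def)
  have P: "p \<in> proj" using qs by (simp add: p alg.paths_def)
  have "q \<cdot> p = q" "p \<cdot> q = q"
    using q P nat_le_iff[of q p] proj_le_imp_commute[of q p] by (simp_all add: p)
  then show "(peval ps, peval qs) \<in> leq"
    using path_product_path_restr[of p qs' q] path_product_Cons_path[of p qs'] ps qs q
      restr_leq(2)[of q "path_product (p # qs')"] by (simp add: p peval_eq)
next
  fix b e f assume b: "b \<in> S" and "wpoc.linked b e f"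
  define e1 f1 e2 f2
    where "e1 = (e \<cdot> b\<^sup>\<oplus>)\<^sup>\<star>" and "f1 = (e \<cdot> b)\<^sup>\<star>" and "e2 = (b \<cdot> f)\<^sup>\<oplus>" and "f2 = (b\<^sup>\<star> \<cdot> f)\<^sup>\<oplus>"
  have e: "e \<in> proj" and f: "f \<in> proj" and l: "f = pstar (wpoc.Theta e b) f" "e = ptimes e (wpoc.Delta f b)"
    using \<open>wpoc.linked b e f\<close> by (simp_all add: wpoc.linked_def)
  note [simp] = projD[OF e] projD[OF f] b
  have T: "wpoc.Theta e b = f1" "wpoc.Delta f b = e2" "pstar e (b\<^sup>\<oplus>) = e1" "ptimes (b\<^sup>\<star>) f = f2"
    using e f by (simp_all add: e1_def f1_def e2_def f2_def Theta_eq Delta_eq pstar_eq ptimes_eq closed)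
  have P: "e1 \<in> proj" "f1 \<in> proj" "e2 \<in> proj" "f2 \<in> proj"
    by (simp_all add: e1_def f1_def e2_def f2_def closed)
  note [simp] = projD[OF P(1)] projD[OF P(2)] projD[OF P(3)] projD[OF P(4)]
  have l: "(f1 \<cdot> f)\<^sup>\<star> = f" "(e \<cdot> e2)\<^sup>\<oplus> = e"
    using l e f P unfolding T by (simp_all add: ptimes_eq pstar_eq)
  note lam = linked_lambda[OF b e f, folded e1_def f1_def e2_def, OF l]
  note rho = linked_rho[OF b e f, folded f1_def e2_def f2_def, OF l]
  have "pcomp (pcomp (peval [e, e1]) (cat.left_restr e1 b)) (peval [f1, f]) = e \<cdot> b \<cdot> f"
  proof -
    have 1: "peval [e, e1] = e \<cdot> e1" "peval [f1, f] = f1 \<cdot> f" "cat.left_restr e1 b = e1 \<cdot> b"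
      using lam l e f P by (simp_all add: peval_pair left_restr_eq)
    have 2: "(e1 \<cdot> b)\<^sup>\<oplus> = e1"
      using restr_leq(1)[OF P(1) b lam(4)] .
    have 3: "(e \<cdot> e1 \<cdot> (e1 \<cdot> b))\<^sup>\<star> = f1"
      using ast_cong[of "e \<cdot> e1" "e1 \<cdot> b"] lam mult_assoc[of e1 e1 b] by (simp add: closed)
    show ?thesis
      unfolding 1 using 2 3 lam by (simp add: pcomp_eq closed)
  qed
  moreover have "pcomp (pcomp (peval [e, e2]) (cat.left_restr e2 b)) (peval [f2, f]) = e \<cdot> b \<cdot> f"
  proof -
    have 1: "peval [e, e2] = e \<cdot> e2" "peval [f2, f] = f2 \<cdot> f" "cat.left_restr e2 b = e2 \<cdot> b"
      using rho l e f P by (simp_all add: peval_pair left_restr_eq)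
    have 2: "(e2 \<cdot> b)\<^sup>\<oplus> = e2"
      using restr_leq(1)[OF P(3) b rho(7)] .
    have 3: "(e \<cdot> e2 \<cdot> (e2 \<cdot> b))\<^sup>\<star> = f2"
      using ast_cong[of "e \<cdot> e2" "e2 \<cdot> b"] rho(3,6) mult_assoc[of e2 e2 b] by (simp add: closed)
    show ?thesis
      unfolding 1 using 2 3 rho(1,2,3,6,8) by (simp add: pcomp_eq closed)
  qed
  ultimately show "let e1 = pstar e (b\<^sup>\<oplus>); e2 = wpoc.Delta f b; f1 = wpoc.Theta e b; f2 = ptimes (b\<^sup>\<star>) f in
      pcomp (pcomp (peval [e, e1]) (cat.left_restr e1 b)) (peval [f1, f]) =
      pcomp (pcomp (peval [e, e2]) (cat.left_restr e2 b)) (peval [f2, f])"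
    by (simp add: T)
qed

end

section \<open>The two constructions are mutually inverse\<close>

context drc_restriction_semigroup
begin

text \<open>The factorization \<open>x \<cdot> y = (x \<cdot> e) \<cdot> (e \<cdot> f) \<cdot> (f \<cdot> y)\<close>, in which \<open>e \<cdot> f\<close> is
  \<open>x\<^sup>\<star> \<cdot> y\<^sup>\<oplus>\<close> and the three factors are composable.\<close>

lemma product_eq_mult:
  assumes "x \<in> S" "y \<in> S"
  shows "cpoc.product x y = x \<cdot> y"
proof -
  define e f where "e = ptimes (x\<^sup>\<star>) (y\<^sup>\<oplus>)" and "f = pstar (x\<^sup>\<star>) (y\<^sup>\<oplus>)"
  note [simp] = assms
  have P: "e \<in> proj" "f \<in> proj"
    by (simp_all add: e_def f_def ptimes_closed pstar_closed closed)
  note [simp] = projD[OF P(1)] projD[OF P(2)]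
  have ef: "e \<cdot> f = x\<^sup>\<star> \<cdot> y\<^sup>\<oplus>"
    using plus_ast_mult[of "x\<^sup>\<star>" "y\<^sup>\<oplus>"] by (simp add: e_def f_def ptimes_eq pstar_eq closed)
  have ef': "(e \<cdot> f)\<^sup>\<oplus> = e" "(e \<cdot> f)\<^sup>\<star> = f"
    unfolding ef by (simp_all add: e_def f_def ptimes_eq pstar_eq closed)
  have ex: "e \<cdot> x\<^sup>\<star> = e" and fy: "y\<^sup>\<oplus> \<cdot> f = f"
    using ptimes_left(2)[of "x\<^sup>\<star>" "y\<^sup>\<oplus>"] ast_below(2)[of "y\<^sup>\<oplus>" "x\<^sup>\<star>"]
    by (simp_all add: e_def f_def pstar_eq closed unary_simps)
  have xe: "(x \<cdot> e)\<^sup>\<star> = e" and yf: "(f \<cdot> y)\<^sup>\<oplus> = f"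
    using right_restr_leq(1)[OF P(1) assms(1) ex] restr_leq(1)[OF P(2) assms(2) fy] by simp_all
  have eef: "e \<cdot> (e \<cdot> f) = e \<cdot> f"
    by (simp flip: mult_assoc)
  have xef: "(x \<cdot> e \<cdot> (e \<cdot> f))\<^sup>\<star> = f"
    using ast_cong[of "x \<cdot> e" "e \<cdot> f"] xe ef' eef by (simp add: closed)
  have "cpoc.product x y = pcomp (pcomp (x \<cdot> e) (e \<cdot> f)) (f \<cdot> y)"
    using P ef' ex fy
    by (simp add: cpoc.product_def right_restr_eq left_restr_eq peval_pair flip: e_def f_def)
  also have "\<dots> = x \<cdot> e \<cdot> (e \<cdot> f) \<cdot> (f \<cdot> y)"
    using xe yf ef' xef by (simp add: pcomp_eq closed)
  also have "\<dots> = x \<cdot> (e \<cdot> f) \<cdot> (f \<cdot> y)"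
    using mult_assoc[of x e "e \<cdot> f"] eef by (simp add: closed)
  also have "\<dots> = x \<cdot> (e \<cdot> f \<cdot> f) \<cdot> y"
    using mult_assoc[of "x \<cdot> (e \<cdot> f)" f y] mult_assoc[of x "e \<cdot> f" f] by (simp add: closed)
  also have "e \<cdot> f \<cdot> f = e \<cdot> f"
    by (simp add: mult_assoc)
  also have "x \<cdot> (e \<cdot> f) \<cdot> y = x \<cdot> x\<^sup>\<star> \<cdot> (y\<^sup>\<oplus> \<cdot> y)"
    unfolding ef by (simp only: assms closed mult_assoc)
  also have "\<dots> = x \<cdot> y"
    by (simp add: mult_ast plus_mult)
  finally show ?thesis .
qed

definition to_cpoc :: "'a cpoc" where
  "to_cpoc = \<lparr>cpoc_carrier = S, cpoc_comp = pcomp, cpoc_dom = plus, cpoc_ran = ast, cpoc_le = leq,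
    cpoc_times = ptimes, cpoc_star = pstar, cpoc_eval = peval\<rparr>"

lemma to_cpoc_paths: "cpoc_objects to_cpoc = proj" "cpoc_paths to_cpoc = alg.paths"
  by (simp_all add: to_cpoc_def cpoc_objects_def cpoc_paths_def)

lemma to_cpoc_mem:
  assumes "plus \<in> extensional S" "ast \<in> extensional S"
  shows "to_cpoc \<in> chain_projection_ordered_categories"
proof -
  have "chain_projection_ordered_category S pcomp plus ast leq ptimes pstar peval"
    by unfold_locales
  then show ?thesis
    using assms to_cpoc_paths
    by (simp add: chain_projection_ordered_categories_def)
      (simp add: to_cpoc_def extensional2_def ptimes_def pstar_def pcomp_def peval_def)
qed

end

context chain_projection_ordered_category
begin

definition to_drc :: "'a drc" where
  "to_drc = \<lparr>drc_carrier = C, drc_mult = product, drc_plus = d, drc_ast = r\<rparr>"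

lemma to_drc_mem:
  assumes "d \<in> extensional C" "r \<in> extensional C"
  shows "to_drc \<in> drc_restriction_semigroups"
  using assms drc_restriction_semigroup_product
  by (simp add: drc_restriction_semigroups_def to_drc_def extensional2_def product_def)

interpretation S: drc_restriction_semigroup C product d r
  by (rule drc_restriction_semigroup_product)

lemma ptimes_eq_times: "\<lbrakk>e \<in> obj; f \<in> obj\<rbrakk> \<Longrightarrow> S.ptimes e f = e \<otimes> f"
  and pstar_eq_star: "\<lbrakk>e \<in> obj; f \<in> obj\<rbrakk> \<Longrightarrow> S.pstar e f = e \<star> f"
proof -
  assume ef: "e \<in> obj" "f \<in> obj"
  note e = objD[OF ef(1)] and f = objD[OF ef(2)]
  have C: "e \<in> C" "f \<in> C" using e f by simp_all
  have p: "e \<otimes> f \<in> obj" "e \<star> f \<in> obj" "(e \<otimes> f, e) \<in> le" "(e \<star> f, f) \<in> le"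
    using product_parts[OF C] e f by simp_all
  have "right_restr e (e \<otimes> f) = e \<otimes> f" "left_restr (e \<star> f) f = e \<star> f"
    using right_restr_unique[OF p(3)] left_restr_unique[OF p(4)] objD[OF p(1)] objD[OF p(2)]
    by simp_all
  then show "S.ptimes e f = e \<otimes> f" "S.pstar e f = e \<star> f"
    using ef e f objD[OF p(1)] objD[OF p(2)] by (simp_all add: S.ptimes_eq S.pstar_eq product nu_def)
qed

lemma leq_eq_le: "S.leq = le"
proof (intro subset_antisym subrelI)
  fix a b assume "(a, b) \<in> S.leq"
  then have ab: "a \<in> C" "b \<in> C" "product (d a) b = a" "product (d b) (d a) = d a"
    by (simp_all add: S.leq_def)
  note o = d_obj[OF ab(1)] d_obj[OF ab(2)]
  have "d b \<otimes> d a = d a"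
    using ptimes_eq_times[OF o(2,1)] S.ptimes_eq[OF o(2,1)] ab(4) objD[OF o(1)] by simp
  then have "(d a, d b) \<in> le"
    using o by (simp add: le_iff_nat_le nat_le_def)
  then show "(a, b) \<in> le"
    using product_object_left[OF o(1) ab(2)] left_restr(2)[OF ab(2) o(1)] ab(3) by simp
next
  fix a b assume ab: "(a, b) \<in> le"
  then have C: "a \<in> C" "b \<in> C" using le_carrier by blast+
  note o = d_obj[OF C(1)] d_obj[OF C(2)]
  have dab: "(d a, d b) \<in> le" using O1[OF ab] by simp
  have "product (d a) b = a"
    using product_object_left[OF o(1) C(2) dab] left_restr_unique[OF ab] by simp
  moreover have "product (d b) (d a) = d a"
    using product_object_right[OF o(1), of "d b"] right_restr_unique[OF dab] dab objD[OF o(1)]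
      objD[OF o(2)] by simp
  ultimately show "(a, b) \<in> S.leq"
    using C by (simp add: S.leq_def)
qed

lemma paths_eq: "S.alg.paths = paths"
proof -
  have "S.alg.friendly p q = friendly p q" if "p \<in> obj" "q \<in> obj" for p q
    using that by (simp add: S.alg.friendly_def friendly_def ptimes_eq_times pstar_eq_star)
  then have "successively S.alg.friendly ps = successively friendly ps" if "set ps \<subseteq> obj" for ps
    using that by (intro successively_cong refl) (metis subsetD)
  then show ?thesis
    by (auto simp: S.alg.paths_def paths_def)
qed

text \<open>Multiplying by the object \<open>p\<close> prefixes the value of the path \<open>(p, q)\<close>, which (E3) joins to the
  value of the remaining path.\<close>

lemma path_product_eq_eval: "p # ps \<in> paths \<Longrightarrow> S.path_product (p # ps) = \<epsilon> (p # ps)"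
proof (induction ps arbitrary: p)
  case Nil
  then show ?case using E1[of p] by (simp add: singleton_path)
next
  case (Cons q ps)
  then have p: "p \<in> obj" and pq: "friendly p q" and qs: "q # ps \<in> paths"
    by (simp_all add: Cons_path)
  have q: "q \<in> obj" using qs by (simp add: paths_def)
  let ?L = "\<epsilon> (q # ps)"
  have L: "?L \<in> C" "d ?L = q" using eval_closed[OF qs] E2[OF qs] by simp_all
  have pq': "p \<otimes> q = p" "p \<star> q = q" using pq by (simp_all add: friendly_def)
  have rr: "right_restr p p = p" "left_restr q ?L = ?L"
    using right_restr_unique[OF le_refl[of p]] left_restr_unique[OF le_refl[of ?L]] objD[OF p] L
    by simp_all
  have "S.path_product (p # q # ps) = product p ?L"
    using Cons.IH[OF qs] by simp
  also have "\<dots> = p \<odot> \<epsilon> [p, q] \<odot> ?L"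
    using objD[OF p] L rr by (simp add: product_def pq')
  also have "\<dots> = \<epsilon> [p, q] \<odot> ?L"
    using d_left[of "\<epsilon> [p, q]"] eval_pair[OF p q pq] by simp
  also have "\<dots> = \<epsilon> (p # q # ps)"
    using E3[of "[p, q]" "q # ps"] qs p q pq by (simp add: pair_path)
  finally show ?case .
qed

text \<open>On their domains the operations agree by the lemmas above. Off the domains both sides are
  undefined, which the hypotheses provide for the given category.\<close>

lemma to_cpoc_eq:
  assumes "\<forall>x y. \<not> (x \<in> C \<and> y \<in> C \<and> r x = d y) \<longrightarrow> x \<odot> y = undefined"
    and "extensional2 obj times" "extensional2 obj star" "\<epsilon> \<in> extensional paths"
  shows "S.to_cpoc = \<lparr>cpoc_carrier = C, cpoc_comp = comp, cpoc_dom = d, cpoc_ran = r,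
    cpoc_le = le, cpoc_times = times, cpoc_star = star, cpoc_eval = \<epsilon>\<rparr>"
proof -
  have 1: "S.pcomp = comp"
  proof (intro ext)
    show "S.pcomp x y = x \<odot> y" for x y
    proof (cases "x \<in> C \<and> y \<in> C \<and> r x = d y")
      case True
      then show ?thesis by (simp add: S.pcomp_eq product_composable)
    next
      case False
      then show ?thesis using assms(1)[rule_format, OF False] unfolding S.pcomp_def by (simp only: if_False)
    qed
  qed
  have 2: "S.ptimes = times"
    using assms(2) unfolding S.ptimes_def extensional2_def
    by (intro ext) (simp add: S.ptimes_eq[symmetric] ptimes_eq_times)
  have 3: "S.pstar = star"
    using assms(3) unfolding S.pstar_def extensional2_def
    by (intro ext) (simp add: S.pstar_eq[symmetric] pstar_eq_star)
  have 4: "S.peval = \<epsilon>"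
  proof (intro extensionalityI[of _ paths])
    show "S.peval ps = \<epsilon> ps" if "ps \<in> paths" for ps
      using that path_product_eq_eval[of "hd ps" "tl ps"]
      by (cases ps) (simp_all add: S.peval_def paths_eq paths_def)
  qed (use assms(4) in \<open>simp_all add: S.peval_def paths_eq\<close>)
  show ?thesis
    unfolding S.to_cpoc_def 1 2 3 4 leq_eq_le ..
qed

end

definition cpoc_of_drc :: "'a drc \<Rightarrow> 'a cpoc" where
  "cpoc_of_drc D = drc_restriction_semigroup.to_cpoc
    (drc_carrier D) (drc_mult D) (drc_plus D) (drc_ast D)"

definition drc_of_cpoc :: "'a cpoc \<Rightarrow> 'a drc" where
  "drc_of_cpoc K = chain_projection_ordered_category.to_drc (cpoc_carrier K) (cpoc_comp K)
    (cpoc_dom K) (cpoc_ran K) (cpoc_le K) (cpoc_times K) (cpoc_star K) (cpoc_eval K)"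

lemma cpoc_of_drc_mem:
  assumes "D \<in> drc_restriction_semigroups"
  shows "cpoc_of_drc D \<in> chain_projection_ordered_categories"
    and "cpoc_carrier (cpoc_of_drc D) = drc_carrier D" and "drc_of_cpoc (cpoc_of_drc D) = D"
proof -
  interpret drc_restriction_semigroup "drc_carrier D" "drc_mult D" "drc_plus D" "drc_ast D"
    using assms by (simp add: drc_restriction_semigroups_def)
  have ext: "extensional2 (drc_carrier D) (drc_mult D)"
    "drc_plus D \<in> extensional (drc_carrier D)" "drc_ast D \<in> extensional (drc_carrier D)"
    using assms by (simp_all add: drc_restriction_semigroups_def)
  show "cpoc_of_drc D \<in> chain_projection_ordered_categories"
    unfolding cpoc_of_drc_def using ext by (intro to_cpoc_mem)
  show "cpoc_carrier (cpoc_of_drc D) = drc_carrier D"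
    by (simp add: cpoc_of_drc_def to_cpoc_def)
  have "cpoc.product x y = drc_mult D x y" for x y
    using ext(1) product_eq_mult[of x y]
    by (cases "x \<in> drc_carrier D \<and> y \<in> drc_carrier D") (auto simp: cpoc.product_def extensional2_def)
  then have "cpoc.product = drc_mult D" by (simp add: fun_eq_iff)
  then show "drc_of_cpoc (cpoc_of_drc D) = D"
    by (simp add: cpoc_of_drc_def drc_of_cpoc_def to_cpoc_def cpoc.to_drc_def)
qed

lemma drc_of_cpoc_mem:
  assumes "K \<in> chain_projection_ordered_categories"
  shows "drc_of_cpoc K \<in> drc_restriction_semigroups" and "cpoc_of_drc (drc_of_cpoc K) = K"
proof -
  interpret chain_projection_ordered_category "cpoc_carrier K" "cpoc_comp K" "cpoc_dom K"
    "cpoc_ran K" "cpoc_le K" "cpoc_times K" "cpoc_star K" "cpoc_eval K"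
    using assms by (simp add: chain_projection_ordered_categories_def)
  show "drc_of_cpoc K \<in> drc_restriction_semigroups"
    unfolding drc_of_cpoc_def using assms
    by (intro to_drc_mem) (simp_all add: chain_projection_ordered_categories_def)
  have "drc_restriction_semigroup.to_cpoc (cpoc_carrier K) product (cpoc_dom K) (cpoc_ran K) = K"
    using assms
    by (subst to_cpoc_eq)
      (simp_all add: chain_projection_ordered_categories_def cpoc_objects_def cpoc_paths_def)
  then show "cpoc_of_drc (drc_of_cpoc K) = K"
    by (simp add: cpoc_of_drc_def drc_of_cpoc_def to_drc_def)
qed

section \<open>Homomorphisms and functors\<close>

lemma drc_hom_imp_cpoc_functor:
  assumes D: "D \<in> drc_restriction_semigroups" and E: "E \<in> drc_restriction_semigroups"
    and \<phi>: "\<phi> \<in> drc_carrier D \<rightarrow> drc_carrier E" and hom: "drc_hom D E \<phi>"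
  shows "cpoc_functor (cpoc_of_drc D) (cpoc_of_drc E) \<phi>"
proof -
  interpret S: drc_restriction_semigroup "drc_carrier D" "drc_mult D" "drc_plus D" "drc_ast D"
    using D by (simp add: drc_restriction_semigroups_def)
  interpret T: drc_restriction_semigroup "drc_carrier E" "drc_mult E" "drc_plus E" "drc_ast E"
    using E by (simp add: drc_restriction_semigroups_def)
  have carr: "\<phi> x \<in> drc_carrier E" if "x \<in> drc_carrier D" for x
    using \<phi> that by blast
  have m: "\<phi> (drc_mult D x y) = drc_mult E (\<phi> x) (\<phi> y)"
    if "x \<in> drc_carrier D" "y \<in> drc_carrier D" for x y
    using hom that by (simp add: drc_hom_def)
  have u: "\<phi> (drc_plus D x) = drc_plus E (\<phi> x)" "\<phi> (drc_ast D x) = drc_ast E (\<phi> x)"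
    if "x \<in> drc_carrier D" for x
    using hom that by (simp_all add: drc_hom_def)
  have proj: "\<phi> p \<in> T.proj" if "p \<in> S.proj" for p
    using S.projD[OF that] u(1)[of p] T.plus_proj[OF carr, of p] by simp
  have leq: "(\<phi> a, \<phi> b) \<in> T.leq" if "(a, b) \<in> S.leq" for a b
  proof -
    have ab: "a \<in> drc_carrier D" "b \<in> drc_carrier D" "drc_mult D (drc_plus D a) b = a"
      "drc_mult D (drc_plus D b) (drc_plus D a) = drc_plus D a"
      using that by (simp_all add: S.leq_def)
    then show ?thesis
      using m[of "drc_plus D a" b] m[of "drc_plus D b" "drc_plus D a"]
      by (simp add: T.leq_def carr u S.closed)
  qed
  have alg: "\<phi> (S.ptimes e f) = T.ptimes (\<phi> e) (\<phi> f)" "\<phi> (S.pstar e f) = T.pstar (\<phi> e) (\<phi> f)"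
    if "e \<in> S.proj" "f \<in> S.proj" for e f
    using that proj[OF that(1)] proj[OF that(2)] S.projD[OF that(1)] S.projD[OF that(2)]
    by (simp_all add: S.ptimes_eq S.pstar_eq T.ptimes_eq T.pstar_eq u m S.closed)
  have path: "map \<phi> (p # ps) \<in> T.alg.paths \<and> \<phi> (S.path_product (p # ps)) = T.path_product (map \<phi> (p # ps))"
    if "p # ps \<in> S.alg.paths" for p ps
    using that
  proof (induction ps arbitrary: p)
    case Nil
    then show ?case using proj by (simp add: S.alg.singleton_path T.alg.singleton_path)
  next
    case (Cons q qs)
    then have p: "p \<in> S.proj" and pq: "S.alg.friendly p q" and qs: "q # qs \<in> S.alg.paths"
      by (simp_all add: S.alg.Cons_path)
    have q: "q \<in> S.proj" using qs by (simp add: S.alg.paths_def)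
    have "T.alg.friendly (\<phi> p) (\<phi> q)"
      using alg[OF p q] pq by (simp add: S.alg.friendly_def T.alg.friendly_def)
    moreover have "\<phi> (drc_mult D p (S.path_product (q # qs))) = drc_mult E (\<phi> p) (\<phi> (S.path_product (q # qs)))"
      using S.path_product_Cons_path[OF qs] S.projD[OF p] by (intro m) simp_all
    ultimately show ?case
      using Cons.IH[OF qs] proj[OF p] by (simp add: T.alg.Cons_path)
  qed
  have eval: "\<phi> (S.peval ps) = T.peval (map \<phi> ps)" if "ps \<in> S.alg.paths" for ps
  proof -
    obtain p ps' where "ps = p # ps'" using \<open>ps \<in> S.alg.paths\<close> by (cases ps) (simp_all add: S.alg.paths_def)
    then show ?thesis
      using that path[of p ps'] by (simp add: S.peval_eq T.peval_eq)
  qed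
  have comp: "\<phi> (S.pcomp a b) = T.pcomp (\<phi> a) (\<phi> b)"
    if "a \<in> drc_carrier D" "b \<in> drc_carrier D" "drc_ast D a = drc_plus D b" for a b
    using that u(2)[of a] u(1)[of b] by (simp add: S.pcomp_eq T.pcomp_eq m carr)
  show ?thesis
    unfolding cpoc_functor_def cpoc_of_drc_def S.to_cpoc_paths
    using u leq alg eval comp by (simp add: S.to_cpoc_def T.to_cpoc_def)
qed

text \<open>A functor commutes with restrictions, because these are characterized by the order together with
  the domain or the range; hence it preserves each of the three factors of a product.\<close>

lemma cpoc_functor_product:
  assumes K: "K \<in> chain_projection_ordered_categories"
    and L: "L \<in> chain_projection_ordered_categories"
    and \<phi>: "\<phi> \<in> cpoc_carrier K \<rightarrow> cpoc_carrier L" and F: "cpoc_functor K L \<phi>"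
    and xy: "x \<in> cpoc_carrier K" "y \<in> cpoc_carrier K"
  shows "\<phi> (drc_mult (drc_of_cpoc K) x y) = drc_mult (drc_of_cpoc L) (\<phi> x) (\<phi> y)"
proof -
  interpret K: chain_projection_ordered_category "cpoc_carrier K" "cpoc_comp K" "cpoc_dom K"
    "cpoc_ran K" "cpoc_le K" "cpoc_times K" "cpoc_star K" "cpoc_eval K"
    using K by (simp add: chain_projection_ordered_categories_def)
  interpret L: chain_projection_ordered_category "cpoc_carrier L" "cpoc_comp L" "cpoc_dom L"
    "cpoc_ran L" "cpoc_le L" "cpoc_times L" "cpoc_star L" "cpoc_eval L"
    using L by (simp add: chain_projection_ordered_categories_def)
  have carr: "\<phi> a \<in> cpoc_carrier L" if "a \<in> cpoc_carrier K" for a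
    using \<phi> that by blast
  have dr: "cpoc_dom L (\<phi> a) = \<phi> (cpoc_dom K a)" "cpoc_ran L (\<phi> a) = \<phi> (cpoc_ran K a)"
    if "a \<in> cpoc_carrier K" for a
    using F that by (simp_all add: cpoc_functor_def)
  have comp: "\<phi> (cpoc_comp K a b) = cpoc_comp L (\<phi> a) (\<phi> b)"
    if "a \<in> cpoc_carrier K" "b \<in> cpoc_carrier K" "cpoc_ran K a = cpoc_dom K b" for a b
    using F that by (simp add: cpoc_functor_def)
  have le: "(\<phi> a, \<phi> b) \<in> cpoc_le L" if "(a, b) \<in> cpoc_le K" for a b
    using F that by (simp add: cpoc_functor_def)
  have alg: "\<phi> (cpoc_times K e f) = cpoc_times L (\<phi> e) (\<phi> f)"
    "\<phi> (cpoc_star K e f) = cpoc_star L (\<phi> e) (\<phi> f)"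
    if "e \<in> K.obj" "f \<in> K.obj" for e f
    using F that by (simp_all add: cpoc_functor_def flip: cpoc_objects_def)
  have eval: "\<phi> (cpoc_eval K ps) = cpoc_eval L (map \<phi> ps)" if "ps \<in> K.paths" for ps
    using F that by (simp add: cpoc_functor_def cpoc_paths_def cpoc_objects_def)
  define p q where "p = cpoc_times K (cpoc_ran K x) (cpoc_dom K y)"
    and "q = cpoc_star K (cpoc_ran K x) (cpoc_dom K y)"
  note parts = K.product_parts[OF xy, folded p_def q_def]
  have p: "\<phi> p = cpoc_times L (cpoc_ran L (\<phi> x)) (cpoc_dom L (\<phi> y))"
    and q: "\<phi> q = cpoc_star L (cpoc_ran L (\<phi> x)) (cpoc_dom L (\<phi> y))"
    using alg[OF K.r_obj[OF xy(1)] K.d_obj[OF xy(2)]] xy by (simp_all add: p_def q_def dr)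
  note rr = K.right_restr[OF xy(1) parts(1,3)] and lr = K.left_restr[OF xy(2) parts(2,4)]
    and ev = K.eval_pair[OF parts(1,2,5)]
  have "\<phi> (K.right_restr x p) = L.right_restr (\<phi> x) (\<phi> p)"
    using L.right_restr_unique[OF le[OF rr(2)]] rr by (simp add: dr)
  moreover have "\<phi> (K.left_restr q y) = L.left_restr (\<phi> q) (\<phi> y)"
    using L.left_restr_unique[OF le[OF lr(2)]] lr by (simp add: dr)
  moreover have "\<phi> (cpoc_eval K [p, q]) = cpoc_eval L [\<phi> p, \<phi> q]"
    using eval[of "[p, q]"] parts by (simp add: K.pair_path)
  ultimately have "\<phi> (K.product x y) = L.product (\<phi> x) (\<phi> y)"
    using xy rr lr ev
    by (simp add: K.product_def L.product_def carr comp K.comp_closed K.r_comp flip: p q p_def q_def)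
  then show ?thesis
    by (simp add: drc_of_cpoc_def K.to_drc_def L.to_drc_def)
qed

lemma cpoc_functor_imp_drc_hom:
  assumes D: "D \<in> drc_restriction_semigroups" and E: "E \<in> drc_restriction_semigroups"
    and \<phi>: "\<phi> \<in> drc_carrier D \<rightarrow> drc_carrier E"
    and F: "cpoc_functor (cpoc_of_drc D) (cpoc_of_drc E) \<phi>"
  shows "drc_hom D E \<phi>"
proof -
  interpret S: drc_restriction_semigroup "drc_carrier D" "drc_mult D" "drc_plus D" "drc_ast D"
    using D by (simp add: drc_restriction_semigroups_def)
  interpret T: drc_restriction_semigroup "drc_carrier E" "drc_mult E" "drc_plus E" "drc_ast E"
    using E by (simp add: drc_restriction_semigroups_def)
  have "\<phi> (drc_mult D x y) = drc_mult E (\<phi> x) (\<phi> y)"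
    if "x \<in> drc_carrier D" "y \<in> drc_carrier D" for x y
    using cpoc_functor_product[OF cpoc_of_drc_mem(1)[OF D] cpoc_of_drc_mem(1)[OF E] _ F, of x y] \<phi> that
    by (simp add: cpoc_of_drc_mem(2,3) D E)
  moreover have "\<phi> (drc_plus D x) = drc_plus E (\<phi> x)" "\<phi> (drc_ast D x) = drc_ast E (\<phi> x)"
    if "x \<in> drc_carrier D" for x
    using F that by (simp_all add: cpoc_functor_def cpoc_of_drc_def S.to_cpoc_def T.to_cpoc_def)
  ultimately show ?thesis by (simp add: drc_hom_def)
qed

theorem theorem6p11:
  shows "isomorphic_categories
    (DRC_category :: ('a drc, 'a drc \<times> ('a \<Rightarrow> 'a) \<times> 'a drc) cat)
    (CPOC_category :: ('a cpoc, 'a cpoc \<times> ('a \<Rightarrow> 'a) \<times> 'a cpoc) cat)"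
  unfolding DRC_category_def CPOC_category_def
proof (rule isomorphic_structure_categories[where F = cpoc_of_drc and G = drc_of_cpoc])
  fix D E :: "'a drc" and \<phi>
  assume "D \<in> drc_restriction_semigroups" "E \<in> drc_restriction_semigroups"
    "\<phi> \<in> drc_carrier D \<rightarrow>\<^sub>E drc_carrier E"
  then show "drc_hom D E \<phi> \<longleftrightarrow> cpoc_functor (cpoc_of_drc D) (cpoc_of_drc E) \<phi>"
    using drc_hom_imp_cpoc_functor cpoc_functor_imp_drc_hom by (metis PiE_iff Pi_I)
next
  fix D :: "'a drc" assume "D \<in> drc_restriction_semigroups"
  then interpret drc_restriction_semigroup "drc_carrier D" "drc_mult D" "drc_plus D" "drc_ast D"
    by (simp add: drc_restriction_semigroups_def)
  show "drc_hom D D (restrict id (drc_carrier D))"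
    by (simp add: drc_hom_def closed)
next
  fix D E F :: "'a drc" and \<phi> \<psi>
  assume "D \<in> drc_restriction_semigroups" and \<phi>: "\<phi> \<in> drc_carrier D \<rightarrow>\<^sub>E drc_carrier E"
    and hom: "drc_hom D E \<phi>" "drc_hom E F \<psi>"
  then interpret drc_restriction_semigroup "drc_carrier D" "drc_mult D" "drc_plus D" "drc_ast D"
    by (simp add: drc_restriction_semigroups_def)
  show "drc_hom D F (compose (drc_carrier D) \<psi> \<phi>)"
    using hom PiE_mem[OF \<phi>] by (simp add: drc_hom_def compose_eq closed)
qed (rule cpoc_of_drc_mem drc_of_cpoc_mem; assumption)+

end
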